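(* The following identity holds in $\mathcal{A}_{\mathbb{Z}[t]}$: \begin{align*} &(1+4t^{\boldsymbol{p}}+t^{2\boldsymbol{p}})\pounds_{\mathcal{A}, \{1\}^4}(t)+2t^{\boldsymbol{p}}(2+t^{\boldsymbol{p}})\pounds^*_{\mathcal{A}, \{1\}^4}(1,1,t,1)+2t^{\boldsymbol{p}}(1+2t^{\boldsymbol{p}})\pounds^*_{\mathcal{A}, \{1\}^4}(1,t,1,1)\\ &+t^{\boldsymbol{p}}(1+4t^{\boldsymbol{p}}+t^{2\boldsymbol{p}})\widetilde{\pounds}_{\mathcal{A}, \{1\}^4}(t)+t^{\boldsymbol{p}}(1+3t^{\boldsymbol{p}})\widetilde{\pounds}_{\mathcal{A}, (2,1,1)}(t)+2t^{\boldsymbol{p}}(1+t^{\boldsymbol{p}})\pounds^*_{\mathcal{A},(1,2,1)}(1,t,1)\\ &+t^{\boldsymbol{p}}(3+t^{\boldsymbol{p}})\pounds_{\mathcal{A},(1,1,2)}(t)+t^{\boldsymbol{p}}\Bigl(\pounds_{\mathcal{A},(2,1,1)}(t)+\pounds^*_{\mathcal{A},(2,1,1)}(1,t,1)+\pounds_{\mathcal{A},(1,2,1)}(t)+\pounds_{\mathcal{A},(2,2)}(t)\Bigr)\\ &+t^{2\boldsymbol{p}}\Bigl(\widetilde{\pounds}_{\mathcal{A},(1,1,2)}(t)+\pounds^*_{\mathcal{A},(1,1,2)}(1,t,1)+\widetilde{\pounds}_{\mathcal{A}, (1,2,1)}(t)+\widetilde{\pounds}_{\mathcal{A},(2,2)}(t)\Bigr)\\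 =\; &(6-6t^{\boldsymbol{p}}+t^{2\boldsymbol{p}})\pounds_{\mathcal{A}, \{1\}^4}(1-t)+2(1-t^{\boldsymbol{p}})(3-t^{\boldsymbol{p}})\pounds^*_{\mathcal{A}, \{1\}^4}(1,1,1-t,1)\\ &+2(1-t^{\boldsymbol{p}})(3-2t^{\boldsymbol{p}})\pounds^*_{\mathcal{A}, \{1\}^4}(1,1-t,1,1)+(1-t^{\boldsymbol{p}})(6-6t^{\boldsymbol{p}}+t^{2\boldsymbol{p}})\widetilde{\pounds}_{\mathcal{A}, \{1\}^4}(1-t)\\ &+(1-t^{\boldsymbol{p}})(4-3t^{\boldsymbol{p}})\widetilde{\pounds}_{\mathcal{A}, (2,1,1)}(1-t)+2(1-t^{\boldsymbol{p}})(2-t^{\boldsymbol{p}})\pounds^*_{\mathcal{A},(1,2,1)}(1,1-t,1)\\ &+(1-t^{\boldsymbol{p}})(4-t^{\boldsymbol{p}})\pounds_{\mathcal{A},(1,1,2)}(1-t)+(1-t^{\boldsymbol{p}})\Bigl(\pounds_{\mathcal{A},(2,1,1)}(1-t)+\pounds^*_{\mathcal{A},(2,1,1)}(1,1-t,1)\\ &\quad+\pounds_{\mathcal{A},(1,2,1)}(1-t)+\pounds_{\mathcal{A},(2,2)}(1-t)\Bigr)+(1-t^{\boldsymbol{p}})^2\Bigl(\widetilde{\pounds}_{\mathcal{A},(1,1,2)}(1-t)+\pounds^*_{\mathcal{A},(1,1,2)}(1,1-t,1)\\ &\quad+\widetilde{\pounds}_{\mathcal{A}, (1,2,1)}(1-t)+\widetilde{\pounds}_{\mathcal{A},(2,2)}(1-t)\Bigr).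 \end{align*}
   Context: Let $\mathcal{A}_{\mathbb{Z}[t]}:=\bigl(\prod_p (\mathbb{Z}/p\mathbb{Z})[t]\bigr)/\bigl(\bigoplus_p (\mathbb{Z}/p\mathbb{Z})[t]\bigr)$, where $p$ runs over all primes; thus two families of polynomials represent the same element if and only if they agree for all but finitely many primes $p$. For variables $\boldsymbol{t}=(t_1,\ldots,t_r)$, define $\mathcal{A}_{\mathbb{Z}[\boldsymbol{t}]}$ in the same way with $(\mathbb{Z}/p\mathbb{Z})[\boldsymbol{t}]$. Let $t^{i\boldsymbol{p}}$ denote the class of $(t^{ip} \bmod p)_p$. Substitutions of polynomials in $t$ for variables are made in each $p$-component. For an index $\mathbf{k}=(k_1,\ldots,k_r)$ of positive integers, define the finite multiple polylogarithms (of Sakugawa--Seki type) $$\pounds^{*}_{\mathcal{A}, \mathbf{k}}(t_1, \ldots, t_r):=\sum_{0<n_1<\cdots<n_r<p}\frac{t_1^{n_1}\cdots t_r^{n_r}}{n_1^{k_1}\cdots n_r^{k_r}}\bmod p \in \mathcal{A}_{\mathbb{Z}[\boldsymbol{t}]},$$ $$\pounds_{\mathcal{A}, \mathbf{k}}(t):=\pounds^*_{\mathcal{A}, \mathbf{k}}(\{1\}^{r-1}, t) \in \mathcal{A}_{\mathbb{Z}[t]},\qquad \widetilde{\pounds}_{\mathcal{A}, \mathbf{k}}(t):=\pounds^*_{\mathcal{A}, \mathbf{k}}(t, \{1\}^{r-1}) \in \mathcal{A}_{\mathbb{Z}[t]}.$$ Here $\{1\}^m$ denotes $1,\ldots,1$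 ($m$ times). *)

theory Defs
  imports
    "HOL-Computational_Algebra.Polynomial"
    "HOL-Computational_Algebra.Primes"
    "HOL-Library.Poly_Mapping"
    "HOL-Number_Theory.Modular_Inverse"
begin

section \<open>The ring \<open>\<A>\<^sub>R\<close>\<close>

text \<open>
  For a commutative ring \<open>R\<close>, the ring \<open>\<A>\<^sub>R\<close> is the product of all \<open>R/pR\<close> (\<open>p\<close> prime) modulo
  their direct sum. An element is given by a family \<open>f\<close> of representatives \<open>f p\<close> in \<open>R\<close>; two
  families are identified iff they agree modulo \<open>p\<close> for all but finitely many primes \<open>p\<close>. Values at
  indices that are not prime are irrelevant. For \<open>R = \<int>[t]\<close> one has \<open>R/pR = (\<int>/p\<int>)[t]\<close>, and
  likewise in several variables. The ring may be trivial (for \<open>R = \<rat>\<close>, say), hence there is no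
  instance of class \<open>comm_ring_1\<close>.
\<close>

definition eq_mod_almost_all_primes :: "(nat \<Rightarrow> 'a::comm_ring_1) \<Rightarrow> (nat \<Rightarrow> 'a) \<Rightarrow> bool" where
  "eq_mod_almost_all_primes f g \<longleftrightarrow> finite {p. prime p \<and> \<not> of_nat p dvd f p - g p}"

lemma eq_mod_almost_all_primes_eqI: "(\<And>p. f p = g p) \<Longrightarrow> eq_mod_almost_all_primes f g"
  by (simp add: eq_mod_almost_all_primes_def)

lemma eq_mod_almost_all_primesI:
  assumes "eq_mod_almost_all_primes f g"
    and "\<And>p. of_nat p dvd f p - g p \<Longrightarrow> of_nat p dvd f' p - g' p"
  shows "eq_mod_almost_all_primes f' g'"
  using assms unfolding eq_mod_almost_all_primes_def
  by (auto elim!: finite_subset[rotated])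

lemma eq_mod_almost_all_primesI2:
  assumes "eq_mod_almost_all_primes f g" "eq_mod_almost_all_primes h k"
    and "\<And>p. of_nat p dvd f p - g p \<Longrightarrow> of_nat p dvd h p - k p \<Longrightarrow> of_nat p dvd f' p - g' p"
  shows "eq_mod_almost_all_primes f' g'"
proof -
  have "finite ({p. prime p \<and> \<not> of_nat p dvd f p - g p} \<union> {p. prime p \<and> \<not> of_nat p dvd h p - k p})"
    using assms(1,2) by (simp add: eq_mod_almost_all_primes_def)
  then show ?thesis
    unfolding eq_mod_almost_all_primes_def by (rule finite_subset[rotated]) (use assms(3) in blast)
qed

lemma equivp_eq_mod_almost_all_primes: "equivp eq_mod_almost_all_primes"
proof (rule equivpI)
  show "reflp (eq_mod_almost_all_primes :: (nat \<Rightarrow> 'a::comm_ring_1) \<Rightarrow> _)"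
    by (auto simp: reflp_def eq_mod_almost_all_primes_def)
  show "symp (eq_mod_almost_all_primes :: (nat \<Rightarrow> 'a::comm_ring_1) \<Rightarrow> _)"
    by (rule sympI) (erule eq_mod_almost_all_primesI, drule dvd_minus_iff[THEN iffD2], simp)
  show "transp (eq_mod_almost_all_primes :: (nat \<Rightarrow> 'a::comm_ring_1) \<Rightarrow> _)"
  proof (rule transpI)
    fix f g h :: "nat \<Rightarrow> 'a"
    assume "eq_mod_almost_all_primes f g" "eq_mod_almost_all_primes g h"
    then show "eq_mod_almost_all_primes f h"
      by (rule eq_mod_almost_all_primesI2) (drule (1) dvd_add, simp)
  qed
qed

quotient_type (overloaded) 'a poor_adele = "nat \<Rightarrow> 'a::comm_ring_1" / eq_mod_almost_all_primes
  by (rule equivp_eq_mod_almost_all_primes)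

instantiation poor_adele :: (comm_ring_1) "{comm_ring, comm_monoid_mult}"
begin

lift_definition zero_poor_adele :: "'a poor_adele" is "\<lambda>_. 0" .

lift_definition one_poor_adele :: "'a poor_adele" is "\<lambda>_. 1" .

lift_definition plus_poor_adele :: "'a poor_adele \<Rightarrow> 'a poor_adele \<Rightarrow> 'a poor_adele"
  is "\<lambda>f g p. f p + g p"
  by (erule (1) eq_mod_almost_all_primesI2) (drule (1) dvd_add, simp add: algebra_simps)

lift_definition uminus_poor_adele :: "'a poor_adele \<Rightarrow> 'a poor_adele"
  is "\<lambda>f p. - f p"
  by (erule eq_mod_almost_all_primesI) (drule dvd_minus_iff[THEN iffD2], simp)

lift_definition minus_poor_adele :: "'a poor_adele \<Rightarrow> 'a poor_adele \<Rightarrow> 'a poor_adele"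
  is "\<lambda>f g p. f p - g p"
  by (erule (1) eq_mod_almost_all_primesI2) (drule (1) dvd_diff, simp add: algebra_simps)

lift_definition times_poor_adele :: "'a poor_adele \<Rightarrow> 'a poor_adele \<Rightarrow> 'a poor_adele"
  is "\<lambda>f g p. f p * g p"
  by (erule (1) eq_mod_almost_all_primesI2) (simp add: mult_diff_mult)

instance
  by intro_classes
    (transfer, rule eq_mod_almost_all_primes_eqI, simp add: algebra_simps)+

end

instance poor_adele :: (comm_ring_1) semiring_numeral ..


section \<open>Multivariate polynomials and substitution\<close>

text \<open>Polynomials over \<open>\<int>\<close> in variables indexed by \<open>nat\<close>, as finitely supported functions on
  exponent vectors\<close>

type_synonym int_mpoly = "(nat \<Rightarrow>\<^sub>0 nat) \<Rightarrow>\<^sub>0 int"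

definition mvar :: "nat \<Rightarrow> int_mpoly" where
  "mvar i = Poly_Mapping.single (Poly_Mapping.single i 1) 1"

definition mpoly_eval :: "(nat \<Rightarrow> 'a::comm_ring_1) \<Rightarrow> int_mpoly \<Rightarrow> 'a" where
  "mpoly_eval x q = (\<Sum>m\<in>Poly_Mapping.keys q. of_int (Poly_Mapping.lookup q m) *
     (\<Prod>i\<in>Poly_Mapping.keys m. x i ^ Poly_Mapping.lookup m i))"

lemma mpoly_eval_superset:
  assumes "finite S" "Poly_Mapping.keys q \<subseteq> S"
  shows "mpoly_eval x q = (\<Sum>m\<in>S. of_int (Poly_Mapping.lookup q m) *
     (\<Prod>i\<in>Poly_Mapping.keys m. x i ^ Poly_Mapping.lookup m i))"
  unfolding mpoly_eval_def using assms
  by (intro sum.mono_neutral_left) (auto simp: in_keys_iff)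

lemma mpoly_eval_diff: "mpoly_eval x (q - r) = mpoly_eval x q - mpoly_eval x r"
proof -
  let ?S = "Poly_Mapping.keys q \<union> Poly_Mapping.keys r"
  have "Poly_Mapping.keys (q - r) \<subseteq> ?S"
    by (auto simp: in_keys_iff lookup_minus)
  then show ?thesis
    by (simp add: mpoly_eval_superset[of ?S] lookup_minus algebra_simps sum_subtractf)
qed

lemma lookup_of_nat_times:
  "Poly_Mapping.lookup (of_nat n * q) m = int n * Poly_Mapping.lookup (q :: int_mpoly) m"
  by (induction n) (simp_all add: algebra_simps lookup_add)

lemma of_nat_dvd_mpoly_eval:
  fixes x :: "nat \<Rightarrow> 'a::comm_ring_1"
  assumes "of_nat n dvd q"
  shows "of_nat n dvd mpoly_eval x q"
proof -
  from assms obtain r where r: "q = of_nat n * r" by (auto simp: dvd_def)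
  have "of_nat n dvd (of_int (Poly_Mapping.lookup q m) :: 'a)" for m
    by (simp add: r lookup_of_nat_times)
  then show ?thesis
    unfolding mpoly_eval_def by (intro dvd_sum dvd_mult2)
qed

lift_definition substitute :: "(nat \<Rightarrow> 'a::comm_ring_1) \<Rightarrow> int_mpoly poor_adele \<Rightarrow> 'a poor_adele"
  is "\<lambda>x f p. mpoly_eval x (f p)"
  by (erule eq_mod_almost_all_primesI) (simp add: of_nat_dvd_mpoly_eval flip: mpoly_eval_diff)


section \<open>Finite multiple polylogarithms\<close>

text \<open>
  Lists are indexed from \<open>0\<close>, so \<open>mvar i\<close> is the variable \<open>t\<^bsub>i+1\<^esub>\<close>. The reciprocal of the
  denominator is taken in \<open>\<int>/p\<int>\<close>; for \<open>p\<close> prime the denominator is coprime to \<open>p\<close>.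
\<close>

lift_definition fin_polylog :: "nat list \<Rightarrow> int_mpoly poor_adele"
  is "\<lambda>ks p. \<Sum>ns | length ns = length ks \<and> sorted_wrt (<) ns \<and> set ns \<subseteq> {0<..<p}.
        of_int (modular_inverse (int p) (\<Prod>i<length ks. int (ns ! i) ^ (ks ! i))) *
        (\<Prod>i<length ks. mvar i ^ (ns ! i))" .

text \<open>Only the first \<open>length ks\<close> variables occur in \<open>fin_polylog ks\<close>, so \<open>xs\<close> is meant to have
  the same length as \<open>ks\<close>.\<close>

definition fin_polylog_star :: "nat list \<Rightarrow> int poly list \<Rightarrow> int poly poor_adele"
    (\<open>\<pounds>\<^sup>*\<close>) where
  "\<pounds>\<^sup>* ks xs = substitute (\<lambda>i. xs ! i) (fin_polylog ks)"

definition fin_polylog_last :: "nat list \<Rightarrow> int poly \<Rightarrow> int poly poor_adele"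
    (\<open>\<pounds>\<close>) where
  "\<pounds> ks x = \<pounds>\<^sup>* ks (replicate (length ks - 1) 1 @ [x])"

definition fin_polylog_first :: "nat list \<Rightarrow> int poly \<Rightarrow> int poly poor_adele"
    (\<open>\<pounds>\<^sup>~\<close>) where
  "\<pounds>\<^sup>~ ks x = \<pounds>\<^sup>* ks (x # replicate (length ks - 1) 1)"

lift_definition tpow :: "nat \<Rightarrow> int poly poor_adele"
  is "\<lambda>i p. monom 1 (i * p)" .

end

theory Submission
  imports Defs "HOL-Computational_Algebra.Formal_Power_Series"
begin

text \<open>
  Both sides of the identity are the same function at two arguments. For an odd prime \<open>p\<close> let
  \[ F_r(x, T) = \sum \frac{T^{des(a)} x^{a_r}}{a_1 \cdots a_r}, \]
  where \<open>a\<close> runs over the sequences of length \<open>r\<close> with entries in \<open>{1, ..., p - 1}\<close> whose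
  neighbouring entries differ, and \<open>des(a)\<close> counts the descents. Modulo \<open>p\<close> and for \<open>x = t\<close>,
  \<open>T = t^p\<close>, this is the sum of \<open>t^(l_1 + ... + l_r)\<close>, divided by the product of all partial sums of
  \<open>l\<close>, over those \<open>l\<close> with entries in \<open>{1, ..., p - 1}\<close> that have no partial sum divisible by \<open>p\<close>:
  \<open>a\<close> consists of the residues of the partial sums, and each descent is a passage over a multiple of
  \<open>p\<close>. Sorting
  the entries of \<open>a\<close> writes \<open>F_4(x, T)\<close> as a combination of sums over increasing sequences, whose
  coefficients are generating polynomials of descents, for instance \<open>1 + 4T + T^2\<close>; this is
  \<open>descent_polylog_4\<close>. It turns the left side of the identity into \<open>F_4(t, t^p)\<close> and the right
  side into \<open>F_4(1 - t, 1 - t^p)\<close>. Hence the identity is the reflection formula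
  \[ F_r(t, t^p) \equiv F_r(1 - t, 1 - t^p) \pmod p, \]
  proved in \<open>descent_polylog_reflection\<close> for all \<open>r\<close> with \<open>2^r < p\<close>, by induction on \<open>r\<close>.

  The reflection formula comes from a differential equation. Modulo \<open>p\<close>, the powers \<open>t^p\<close> are
  constants of the derivation, and differentiating removes the last denominator \<open>a_r\<close>. Summing the
  geometric progressions in \<open>a_r\<close> yields
  \[ x (1 - x) F_r' \equiv x' (x - T) F_{r-1} - x' (x^p - T x) F_{r-1}(1, T) \]
  if \<open>r > 1\<close>. By \<open>descent_polylog_at_1_cong_0\<close> the last term vanishes. As \<open>x = t\<close>, \<open>T = t^p\<close> and
  \<open>x = 1 - t\<close>, \<open>T = 1 - t^p\<close> give the same \<open>x (1 - x)\<close> and the same \<open>x' (x - T)\<close>, the two sides of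
  the reflection formula have the same derivative modulo \<open>p\<close>. Their difference is therefore a
  polynomial in \<open>t^p\<close> modulo \<open>p\<close>; it is zero because neither side contains a monomial whose exponent
  is divisible by \<open>p\<close>, the second one again because \<open>F_r(1, T)\<close> vanishes.

  That vanishing is seen on the generating function \<open>G\<close> of the \<open>F_r(1, T)\<close>, \<open>r > 0\<close>, which satisfies
  the exact identity
  \[ (1 + G) \prod_{0 < k < p} (1 + T X / k) = (1 + T G) \prod_{0 < k < p} (1 + X / k). \]
  The set of all \<open>1/k\<close> is stable under multiplication by \<open>2\<close>, so the \<open>j\<close>-th elementary symmetric
  function of it is annihilated by \<open>2^j - 1\<close> and vanishes for \<open>j > 0\<close>, \<open>2^j < p\<close>. In low degrees
  both products are thus \<open>1\<close>, and \<open>(1 - T) G\<close> vanishes there.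
\<close>


section \<open>Congruence modulo a natural number in a commutative ring\<close>

definition cong_mod :: "'a::comm_ring_1 \<Rightarrow> nat \<Rightarrow> 'a \<Rightarrow> bool"
    (\<open>(_ \<simeq>\<^bsub>_\<^esub> _)\<close> [51, 0, 51] 50) where
  "a \<simeq>\<^bsub>p\<^esub> b \<longleftrightarrow> of_nat p dvd a - b"

lemma cong_mod_refl [simp, intro]: "a \<simeq>\<^bsub>p\<^esub> a"
  by (simp add: cong_mod_def)

lemma cong_mod_sym: "a \<simeq>\<^bsub>p\<^esub> b \<Longrightarrow> b \<simeq>\<^bsub>p\<^esub> a"
  unfolding cong_mod_def by (metis dvd_minus_iff minus_diff_eq)

lemma cong_mod_trans [trans]: "a \<simeq>\<^bsub>p\<^esub> b \<Longrightarrow> b \<simeq>\<^bsub>p\<^esub> c \<Longrightarrow> a \<simeq>\<^bsub>p\<^esub> c"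
  unfolding cong_mod_def by (drule (1) dvd_add) simp

lemma cong_mod_eq_trans [trans]: "a \<simeq>\<^bsub>p\<^esub> b \<Longrightarrow> b = c \<Longrightarrow> a \<simeq>\<^bsub>p\<^esub> c"
  by simp

lemma eq_cong_mod_trans [trans]: "a = b \<Longrightarrow> b \<simeq>\<^bsub>p\<^esub> c \<Longrightarrow> a \<simeq>\<^bsub>p\<^esub> c"
  by simp

lemma cong_mod_add: "a \<simeq>\<^bsub>p\<^esub> b \<Longrightarrow> c \<simeq>\<^bsub>p\<^esub> d \<Longrightarrow> a + c \<simeq>\<^bsub>p\<^esub> b + d"
  unfolding cong_mod_def by (drule (1) dvd_add) (simp add: algebra_simps)

lemma cong_mod_diff: "a \<simeq>\<^bsub>p\<^esub> b \<Longrightarrow> c \<simeq>\<^bsub>p\<^esub> d \<Longrightarrow> a - c \<simeq>\<^bsub>p\<^esub> b - d"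
  unfolding cong_mod_def by (drule (1) dvd_diff) (simp add: algebra_simps)

lemma cong_mod_mult: "a \<simeq>\<^bsub>p\<^esub> b \<Longrightarrow> c \<simeq>\<^bsub>p\<^esub> d \<Longrightarrow> a * c \<simeq>\<^bsub>p\<^esub> b * d"
  unfolding cong_mod_def by (simp add: mult_diff_mult)

lemma cong_mod_sum: "(\<And>i. i \<in> A \<Longrightarrow> f i \<simeq>\<^bsub>p\<^esub> g i) \<Longrightarrow> sum f A \<simeq>\<^bsub>p\<^esub> sum g A"
  by (induction A rule: infinite_finite_induct) (auto intro: cong_mod_add)

lemma cong_mod_prod: "(\<And>i. i \<in> A \<Longrightarrow> f i \<simeq>\<^bsub>p\<^esub> g i) \<Longrightarrow> prod f A \<simeq>\<^bsub>p\<^esub> prod g A"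
  by (induction A rule: infinite_finite_induct) (auto intro: cong_mod_mult)

lemma cong_mod_power: "a \<simeq>\<^bsub>p\<^esub> b \<Longrightarrow> a ^ n \<simeq>\<^bsub>p\<^esub> b ^ n"
  by (induction n) (auto intro: cong_mod_mult)

lemma cong_mod_of_int: "[a = b] (mod int p) \<Longrightarrow> of_int a \<simeq>\<^bsub>p\<^esub> of_int b"
  unfolding cong_mod_def cong_iff_dvd_diff
  by (metis of_int_diff of_int_of_nat_eq of_int_mult dvd_def)

lemma cong_mod_fps_nth: "f \<simeq>\<^bsub>p\<^esub> g \<Longrightarrow> fps_nth f n \<simeq>\<^bsub>p\<^esub> fps_nth g n"
  unfolding cong_mod_def by (auto simp: dvd_def fps_eq_iff simp flip: fps_of_nat)

lemma of_nat_dvd_int_poly_iff: "(of_nat p :: int poly) dvd f \<longleftrightarrow> (\<forall>n. int p dvd coeff f n)"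
  by (simp add: of_nat_poly const_poly_dvd_iff)

text \<open>
  A prime number remains a prime element of \<open>\<int>[t]\<close>.
\<close>

lemma cong_mod_cancel:
  fixes c f g :: "int poly"
  assumes "prime p" "c * f \<simeq>\<^bsub>p\<^esub> c * g" "\<not> of_nat p dvd c"
  shows "f \<simeq>\<^bsub>p\<^esub> g"
proof -
  have "prime_elem (of_nat p :: int poly)"
    using assms(1) by (simp add: of_nat_poly prime_elem_const_poly_iff)
  moreover have "of_nat p dvd c * (f - g)"
    using assms(2) by (simp add: cong_mod_def algebra_simps)
  ultimately show ?thesis
    using assms(3) by (auto simp: cong_mod_def prime_elem_dvd_mult_iff)
qed

lemma freshmans_dream_one_minus:
  assumes "prime p" "odd p"
  shows "(1 - t) ^ p \<simeq>\<^bsub>p\<^esub> 1 - (t :: 'a::comm_ring_1) ^ p"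
proof -
  have "(1 - t) ^ p = (\<Sum>k\<le>p. of_nat (p choose k) * (- t) ^ k)"
    using binomial_ring[of "- t" 1 p] by simp
  also have "\<dots> \<simeq>\<^bsub>p\<^esub> (\<Sum>k\<le>p. if k = 0 then 1 else if k = p then (- t) ^ p else 0)"
  proof (rule cong_mod_sum)
    fix k assume k: "k \<in> {..p}"
    have "p dvd p choose k" if "k \<noteq> 0" "k \<noteq> p"
      using that k assms(1) by (intro dvd_choose_prime) auto
    then have "of_nat p dvd (of_nat (p choose k) :: 'a)" if "k \<noteq> 0" "k \<noteq> p"
      using that by (auto simp: dvd_def)
    then show "of_nat (p choose k) * (- t) ^ k \<simeq>\<^bsub>p\<^esub> (if k = 0 then 1 else if k = p then (- t) ^ p else 0)"
      by (auto simp: cong_mod_def)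
  qed
  also have "(\<Sum>k\<le>p. if k = 0 then 1 else if k = p then (- t) ^ p else 0) = 1 - t ^ p"
    using assms prime_gt_0_nat[OF assms(1)]
    by (subst sum.remove[of _ 0], simp, simp, subst sum.remove[of _ p]) (auto intro!: sum.neutral)
  finally show ?thesis .
qed

lemma pderiv_sum: "pderiv (sum f A) = (\<Sum>i\<in>A. pderiv (f i))"
  by (induction A rule: infinite_finite_induct) (simp_all add: pderiv_add)

lemma smult_of_nat_eq: "smult (of_nat n) f = of_nat n * f"
  by (simp add: of_nat_poly)


section \<open>Reciprocals modulo a prime\<close>

definition recip :: "nat \<Rightarrow> nat \<Rightarrow> 'a::comm_ring_1" where
  "recip p a = of_int (modular_inverse (int p) (int a))"

lemma recip_cong:
  assumes "prime p" "0 < a" "a < p"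
  shows "of_nat a * recip p a \<simeq>\<^bsub>p\<^esub> 1"
proof -
  have "coprime a p"
    using assms by (metis coprime_commute prime_imp_coprime nat_dvd_not_less)
  then have "[int a * modular_inverse (int p) (int a) = 1] (mod int p)"
    by (intro cong_modular_inverse1) simp
  from cong_mod_of_int[OF this] show ?thesis by (simp add: recip_def)
qed


section \<open>Sums over sequences weighted by descents\<close>

text \<open>
  The coefficient of \<open>x^d\<close> in the polylogarithm below is \<open>v d\<close> times the sum over all sequences
  \<open>a_1, ..., a_r\<close> for which neighbours in \<open>a_1, ..., a_r, d\<close> differ, of the product of the \<open>v a_i\<close>
  times \<open>T\<close> to the number of descents of \<open>a_1, ..., a_r, d\<close>. Removing \<open>d\<close> and splitting by the
  comparison of \<open>a_r\<close> with \<open>d\<close> gives the recursion. The value \<open>1\<close> of the polylogarithm of depth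
  \<open>0\<close> is the one for which the differential equation holds in depth \<open>1\<close>, too.
\<close>

fun descent_sum :: "nat \<Rightarrow> (nat \<Rightarrow> 'a::comm_ring_1) \<Rightarrow> 'a \<Rightarrow> nat \<Rightarrow> nat \<Rightarrow> 'a" where
  "descent_sum p v T 0 d = 1"
| "descent_sum p v T (Suc r) d =
     (\<Sum>a\<in>{0<..<d}. v a * descent_sum p v T r a) + T * (\<Sum>a\<in>{d<..<p}. v a * descent_sum p v T r a)"

fun descent_polylog :: "nat \<Rightarrow> (nat \<Rightarrow> 'a::comm_ring_1) \<Rightarrow> 'a \<Rightarrow> nat \<Rightarrow> 'a \<Rightarrow> 'a" where
  "descent_polylog p v T 0 x = 1"
| "descent_polylog p v T (Suc r) x = (\<Sum>d\<in>{0<..<p}. v d * descent_sum p v T r d * x ^ d)"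


section \<open>Vanishing at 1\<close>

text \<open>
  Let \<open>U d\<close> be the generating function of the descent sums at \<open>d\<close> and \<open>y d = v d X U d\<close>. The
  recursion says that \<open>U d\<close> is \<open>1\<close> plus all \<open>y a\<close> with \<open>a < d\<close> plus \<open>T\<close> times all \<open>y a\<close> with
  \<open>a > d\<close>. In the sum \<open>A m\<close> where \<open>y a\<close> carries the factor \<open>T\<close> exactly for \<open>a > m\<close>, passing from
  \<open>m - 1\<close> to \<open>m\<close> changes only the term \<open>y m\<close>: the sum is \<open>U m + T y m = (1 + T v m X) U m\<close>
  before and \<open>U m + y m = (1 + v m X) U m\<close> after that step. The two ends of the resulting product formula are
  \<open>A 0 = 1 + T G\<close> and \<open>A (p - 1) = 1 + G\<close>.
\<close>

lemma descent_polylog_product_formula: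
  fixes p :: nat and v :: "nat \<Rightarrow> 'a::comm_ring_1" and T :: 'a
  defines "G \<equiv> Abs_fps (\<lambda>r. if r = 0 then 0 else descent_polylog p v T r 1)"
  assumes "0 < p"
  shows "(1 + G) * (\<Prod>k\<in>{0<..<p}. 1 + fps_const (T * v k) * fps_X)
    = (1 + fps_const T * G) * (\<Prod>k\<in>{0<..<p}. 1 + fps_const (v k) * fps_X)"
proof -
  define U where "U d = Abs_fps (\<lambda>r. descent_sum p v T r d)" for d
  define y where "y d = fps_const (v d) * fps_X * U d" for d
  have y_nth: "fps_nth (y d) r = (if r = 0 then 0 else v d * descent_sum p v T (r - 1) d)" for d r
    by (simp add: y_def U_def mult.assoc)
  have U: "U d = 1 + sum y {0<..<d} + fps_const T * sum y {d<..<p}" for d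
  proof (rule fps_ext)
    fix r show "fps_nth (U d) r = fps_nth (1 + sum y {0<..<d} + fps_const T * sum y {d<..<p}) r"
      by (cases r) (simp_all add: U_def fps_sum_nth y_nth)
  qed
  have G: "G = sum y {0<..<p}"
  proof (rule fps_ext)
    fix r show "fps_nth G r = fps_nth (sum y {0<..<p}) r"
      by (cases r) (simp_all add: G_def fps_sum_nth y_nth)
  qed
  define A where "A m = 1 + sum y {0<..<Suc m} + fps_const T * sum y {m<..<p}" for m
  have A_step: "A (Suc m) * (1 + fps_const (T * v (Suc m)) * fps_X)
      = A m * (1 + fps_const (v (Suc m)) * fps_X)" if "Suc m < p" for m
  proof -
    have "{0<..<Suc (Suc m)} = insert (Suc m) {0<..<Suc m}" "{m<..<p} = insert (Suc m) {Suc m<..<p}"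
      using that by auto
    then have "A (Suc m) = U (Suc m) + y (Suc m)" "A m = U (Suc m) + fps_const T * y (Suc m)"
      by (simp_all add: A_def U algebra_simps)
    moreover have "y (Suc m) = fps_const (v (Suc m)) * fps_X * U (Suc m)"
      by (simp only: y_def)
    ultimately show ?thesis
      by (simp add: algebra_simps flip: fps_const_mult)
  qed
  have main: "A m * (\<Prod>k\<in>{0<..<Suc m}. 1 + fps_const (T * v k) * fps_X)
      = A 0 * (\<Prod>k\<in>{0<..<Suc m}. 1 + fps_const (v k) * fps_X)" if "m < p" for m
    using that
  proof (induction m)
    case (Suc m)
    have ins: "{0<..<Suc (Suc m)} = insert (Suc m) {0<..<Suc m}" by auto
    let ?P = "\<Prod>k\<in>{0<..<Suc m}. 1 + fps_const (T * v k) * fps_X"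
    have "A (Suc m) * (\<Prod>k\<in>{0<..<Suc (Suc m)}. 1 + fps_const (T * v k) * fps_X)
        = A (Suc m) * (1 + fps_const (T * v (Suc m)) * fps_X) * ?P"
      by (simp add: ins algebra_simps)
    also have "A (Suc m) * (1 + fps_const (T * v (Suc m)) * fps_X)
        = A m * (1 + fps_const (v (Suc m)) * fps_X)"
      using Suc.prems by (rule A_step)
    also have "\<dots> * ?P = A m * ?P * (1 + fps_const (v (Suc m)) * fps_X)"
      by (simp only: mult_ac)
    also have "A m * ?P = A 0 * (\<Prod>k\<in>{0<..<Suc m}. 1 + fps_const (v k) * fps_X)"
      using Suc by simp
    finally show ?case
      by (simp add: ins mult_ac)
  next
    case 0
    have "{0<..<Suc 0} = {}" by auto
    then show ?case by simp
  qed
  have "{p - Suc 0<..<p} = {}" "{0<..<Suc 0} = {}" by auto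
  with main[of "p - 1"] assms(2) show ?thesis
    by (simp add: A_def G)
qed

lemma fps_nth_prod_scale:
  assumes "finite A"
  shows "fps_nth (\<Prod>k\<in>A. 1 + fps_const (c * v k) * fps_X) n
    = c ^ n * fps_nth (\<Prod>k\<in>A. 1 + fps_const (v k :: 'a::comm_ring_1) * fps_X) n"
  using assms
proof (induction A arbitrary: n rule: finite_induct)
  case (insert a A)
  show ?case
    by (cases n) (simp_all add: insert distrib_right mult.assoc, simp add: algebra_simps)
qed simp

lemma not_prime_dvd_double:
  fixes p k :: nat
  assumes "prime p" "odd p" "k \<in> {0<..<p}"
  shows "\<not> p dvd 2 * k"
proof
  assume "p dvd 2 * k"
  then have "p dvd 2 \<or> p dvd k" using assms(1) by (simp add: prime_dvd_mult_iff)
  then show False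
    using assms primes_dvd_imp_eq[of p 2] by (auto dest: dvd_imp_le)
qed

text \<open>
  Multiplication by \<open>2\<close> permutes the reciprocals modulo \<open>p\<close>. The factor \<open>2\<close> serves as a cheap
  substitute for a primitive root; the price is the bound \<open>2^j < p\<close> in place of \<open>j < p - 1\<close> below.
\<close>

lemma recip_double_cong:
  assumes "prime p" "odd p" "k \<in> {0<..<p}"
  shows "recip p k \<simeq>\<^bsub>p\<^esub> (2 * recip p (2 * k mod p) :: 'a::comm_ring_1)"
proof -
  have "\<not> p dvd 2 * k"
    using assms by (rule not_prime_dvd_double)
  then have m: "0 < 2 * k mod p" "2 * k mod p < p"
    using assms by (auto simp: mod_greater_zero_iff_not_dvd prime_gt_0_nat)
  have "[int (2 * k mod p) = int (2 * k)] (mod int p)"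
    by (simp add: cong_def zmod_int)
  from cong_mod_of_int[OF this] have 2: "of_nat (2 * k mod p) \<simeq>\<^bsub>p\<^esub> (2 * of_nat k :: 'a)"
    by simp
  have "recip p k \<simeq>\<^bsub>p\<^esub> recip p k * (of_nat (2 * k mod p) * recip p (2 * k mod p) :: 'a)"
    using cong_mod_mult[OF cong_mod_refl cong_mod_sym[OF recip_cong[OF assms(1) m]], of "recip p k"]
    by simp
  also have "\<dots> \<simeq>\<^bsub>p\<^esub> recip p k * (2 * of_nat k * recip p (2 * k mod p))"
    by (intro cong_mod_mult 2 cong_mod_refl)
  also have "\<dots> = of_nat k * recip p k * (2 * recip p (2 * k mod p))"
    by (simp only: mult_ac)
  also have "\<dots> \<simeq>\<^bsub>p\<^esub> 1 * (2 * recip p (2 * k mod p))"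
    using assms by (intro cong_mod_mult recip_cong cong_mod_refl) auto
  finally show ?thesis by simp
qed

lemma bij_betw_double_mod:
  fixes p :: nat
  assumes "prime p" "odd p"
  shows "bij_betw (\<lambda>k. 2 * k mod p) {0<..<p} {0<..<p}"
proof -
  have "(\<lambda>k. 2 * k mod p) ` {0<..<p} \<subseteq> {0<..<p}"
  proof safe
    fix k assume "k \<in> {0<..<p}"
    with assms have "\<not> p dvd 2 * k"
      by (rule not_prime_dvd_double)
    then show "2 * k mod p \<in> {0<..<p}"
      using assms by (auto simp: mod_greater_zero_iff_not_dvd prime_gt_0_nat)
  qed
  moreover have "inj_on (\<lambda>k. 2 * k mod p) {0<..<p}"
  proof (rule inj_onI)
    fix k l assume *: "k \<in> {0<..<p}" "l \<in> {0<..<p}" "2 * k mod p = 2 * l mod p"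
    then have "[2 * k = 2 * l] (mod p)" by (simp add: cong_def)
    then have "[k = l] (mod p)"
      using assms by (subst (asm) cong_mult_lcancel_nat) auto
    then show "k = l" using * by (simp add: cong_def)
  qed
  ultimately show ?thesis
    by (simp add: bij_betw_def endo_inj_surj)
qed

text \<open>
  Scaling all the reciprocals by \<open>2\<close> multiplies this coefficient by \<open>2^j\<close>, but only permutes the
  factors of the product; and \<open>2^j - 1\<close> is between \<open>0\<close> and \<open>p\<close>.
\<close>

lemma elementary_symmetric_recip_cong_0:
  fixes j :: nat
  assumes "prime p" "0 < j" "2 ^ j < p"
  shows "fps_nth (\<Prod>k\<in>{0<..<p}. 1 + fps_const (recip p k :: int poly) * fps_X) j \<simeq>\<^bsub>p\<^esub> 0"
    (is "?e \<simeq>\<^bsub>p\<^esub> 0")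
proof -
  have "p > 2"
    using assms(2,3) power_increasing[of 1 j "2::nat"] by simp
  then have "odd p" using assms(1) by (simp add: prime_odd_nat)
  let ?r = "recip p :: nat \<Rightarrow> int poly"
  have "(\<Prod>k\<in>{0<..<p}. 1 + fps_const (?r k) * fps_X)
      \<simeq>\<^bsub>p\<^esub> (\<Prod>k\<in>{0<..<p}. 1 + fps_const (2 * ?r (2 * k mod p)) * fps_X)"
  proof (intro cong_mod_prod cong_mod_add cong_mod_mult cong_mod_refl)
    fix k assume "k \<in> {0<..<p}"
    from recip_double_cong[OF assms(1) \<open>odd p\<close> this]
    have "of_nat p dvd ?r k - 2 * ?r (2 * k mod p)" unfolding cong_mod_def .
    then show "fps_const (?r k) \<simeq>\<^bsub>p\<^esub> fps_const (2 * ?r (2 * k mod p))"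
      unfolding cong_mod_def dvd_def by (metis fps_const_mult fps_const_sub fps_of_nat)
  qed
  also have "\<dots> = (\<Prod>k\<in>{0<..<p}. 1 + fps_const (2 * ?r k) * fps_X)"
    using bij_betw_double_mod[OF assms(1) \<open>odd p\<close>]
    by (rule prod.reindex_bij_betw)
  finally have "?e \<simeq>\<^bsub>p\<^esub> 2 ^ j * ?e"
    using cong_mod_fps_nth by (fastforce simp: fps_nth_prod_scale)
  then have "of_nat p dvd (2 ^ j - 1) * (0 - ?e)"
    by (simp add: cong_mod_def algebra_simps)
  then have "(2 ^ j - 1) * 0 \<simeq>\<^bsub>p\<^esub> (2 ^ j - 1) * ?e"
    by (simp add: cong_mod_def algebra_simps)
  moreover have "\<not> of_nat p dvd (2 ^ j - 1 :: int poly)"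
  proof
    assume "of_nat p dvd (2 ^ j - 1 :: int poly)"
    moreover have "(2 ^ j - 1 :: int poly) = of_int (2 ^ j - 1)"
      by simp
    ultimately have "int p dvd 2 ^ j - 1"
      by (simp only: of_nat_poly of_int_poly) simp
    moreover have "(2::int) ^ j > 1" using assms(2) by simp
    moreover have "(2::int) ^ j < int p" using assms(3)
      by (metis of_nat_less_iff of_nat_numeral of_nat_power)
    ultimately show False
      by (auto dest!: zdvd_imp_le)
  qed
  ultimately show ?thesis
    using cong_mod_cancel[OF assms(1)] cong_mod_sym by blast
qed

text \<open>
  Up to degree \<open>r\<close> both products in the product formula are \<open>1\<close> modulo \<open>p\<close>, so the coefficient of
  \<open>X^r\<close> in that formula reads \<open>G_r = T G_r\<close>.
\<close>

lemma descent_polylog_at_1_cong_0: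
  fixes T :: "int poly"
  assumes "prime p" "0 < r" "2 ^ r < p" "\<not> of_nat p dvd 1 - T"
  shows "descent_polylog p (recip p) T r 1 \<simeq>\<^bsub>p\<^esub> 0"
proof -
  define G where "G = Abs_fps (\<lambda>r. if r = 0 then 0 else descent_polylog p (recip p) T r 1)"
  define E where "E c = (\<Prod>k\<in>{0<..<p}. 1 + fps_const (c * recip p k) * fps_X :: int poly fps)" for c
  have E_nth: "fps_nth (E c) j \<simeq>\<^bsub>p\<^esub> (if j = 0 then 1 else 0)" if "j \<le> r" for c j
  proof (cases "j = 0")
    case False
    have "2 ^ j < p"
      using that assms(3) by (meson le_less_trans one_le_numeral power_increasing)
    from cong_mod_mult[OF cong_mod_refl elementary_symmetric_recip_cong_0[OF assms(1) _ this], of "c ^ j"]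
    show ?thesis using False by (simp add: E_def fps_nth_prod_scale)
  next
    case True
    have "fps_nth (\<Prod>k\<in>A. 1 + fps_const (c * recip p k) * fps_X :: int poly fps) 0 = 1" for A
      by (induction A rule: infinite_finite_induct) simp_all
    then show ?thesis using True by (simp add: E_def)
  qed
  have mult_E: "fps_nth (H * E c) r \<simeq>\<^bsub>p\<^esub> fps_nth H r" for H c
  proof -
    have "fps_nth (H * E c) r \<simeq>\<^bsub>p\<^esub> (\<Sum>i=0..r. fps_nth H i * (if r - i = 0 then 1 else 0))"
      unfolding fps_mult_nth by (intro cong_mod_sum cong_mod_mult E_nth cong_mod_refl) auto
    also have "\<dots> = (\<Sum>i=0..r. if i = r then fps_nth H i else 0)"
      by (intro sum.cong) auto
    finally show ?thesis by simp
  qed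
  have "(1 + G) * E T = (1 + fps_const T * G) * E 1"
    unfolding G_def E_def using descent_polylog_product_formula[of p "recip p" T] prime_gt_0_nat[OF assms(1)]
    by simp
  then have "fps_nth (1 + G) r \<simeq>\<^bsub>p\<^esub> fps_nth (1 + fps_const T * G) r"
    using cong_mod_trans[OF cong_mod_sym[OF mult_E[of "1 + G" T]] ] mult_E[of "1 + fps_const T * G" 1]
    by simp
  then have "(1 - T) * fps_nth G r \<simeq>\<^bsub>p\<^esub> (1 - T) * 0"
    using assms(2) by (simp add: cong_mod_def algebra_simps)
  from cong_mod_cancel[OF assms(1) this assms(4)] show ?thesis
    using assms(2) by (simp add: G_def)
qed


section \<open>The reflection formula\<close>

lemma sum_power_greaterThanLessThan:
  fixes x :: "'a::comm_ring_1"
  assumes "a < b"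
  shows "(1 - x) * (\<Sum>d\<in>{a<..<b}. x ^ d) = x ^ Suc a - x ^ b"
proof -
  have "(\<Sum>d = Suc a..<b. x ^ Suc d - x ^ d) = x ^ b - x ^ Suc a"
    using assms by (intro sum_Suc_diff') simp
  moreover have "{a<..<b} = {Suc a..<b}" by auto
  ultimately show ?thesis
    by (simp add: left_diff_distrib sum_subtractf sum_distrib_left)
      (metis minus_diff_eq)
qed

text \<open>
  Interchange the sums over \<open>d\<close> and over the last entry \<open>a\<close> before it: the entry \<open>a\<close> is followed by
  the geometric progression of all \<open>x^d\<close> with \<open>d > a\<close>, and with a factor \<open>T\<close> by the one with
  \<open>d < a\<close>. Multiplied by \<open>1 - x\<close>, they telescope to \<open>x^(a + 1) - x^p + T (x - x^a)\<close>.
\<close>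

lemma descent_sum_generating_function:
  fixes x :: "'a::comm_ring_1"
  assumes "0 < p"
  shows "(1 - x) * (\<Sum>d\<in>{0<..<p}. descent_sum p v T (Suc r) d * x ^ d)
    = (x - T) * descent_polylog p v T (Suc r) x - (x ^ p - T * x) * descent_polylog p v T (Suc r) 1"
proof -
  define I where "I = {0<..<p}"
  define y where "y a = v a * descent_sum p v T r a" for a
  have "(\<Sum>d\<in>I. descent_sum p v T (Suc r) d * x ^ d)
      = (\<Sum>d\<in>I. \<Sum>a\<in>I. y a * (if a < d then x ^ d else 0) + T * y a * (if d < a then x ^ d else 0))"
  proof (rule sum.cong)
    fix d assume "d \<in> I"
    then have *: "{0<..<d} = {a\<in>I. a < d}" "{d<..<p} = {a\<in>I. d < a}" by (auto simp: I_def)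
    have "sum y {0<..<d} * x ^ d = (\<Sum>a\<in>I. y a * (if a < d then x ^ d else 0))"
      unfolding * sum_distrib_right by (subst sum.inter_filter) (auto simp: I_def intro!: sum.cong)
    moreover have "T * sum y {d<..<p} * x ^ d = (\<Sum>a\<in>I. T * y a * (if d < a then x ^ d else 0))"
      unfolding * sum_distrib_right sum_distrib_left
      by (subst sum.inter_filter) (auto simp: I_def intro!: sum.cong)
    ultimately show "descent_sum p v T (Suc r) d * x ^ d
      = (\<Sum>a\<in>I. y a * (if a < d then x ^ d else 0) + T * y a * (if d < a then x ^ d else 0))"
      by (simp only: descent_sum.simps y_def[symmetric] sum.distrib distrib_right)
  qed simp
  also have "\<dots> = (\<Sum>a\<in>I. \<Sum>d\<in>I. y a * (if a < d then x ^ d else 0) + T * y a * (if d < a then x ^ d else 0))"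
    by (rule sum.swap)
  also have "\<dots> = (\<Sum>a\<in>I. y a * (\<Sum>d\<in>{a<..<p}. x ^ d) + T * y a * (\<Sum>d\<in>{0<..<a}. x ^ d))"
  proof (rule sum.cong)
    fix a assume "a \<in> I"
    then have *: "{a<..<p} = {d\<in>I. a < d}" "{0<..<a} = {d\<in>I. d < a}" by (auto simp: I_def)
    show "(\<Sum>d\<in>I. y a * (if a < d then x ^ d else 0) + T * y a * (if d < a then x ^ d else 0))
      = y a * (\<Sum>d\<in>{a<..<p}. x ^ d) + T * y a * (\<Sum>d\<in>{0<..<a}. x ^ d)"
      unfolding * sum.distrib by (simp only: sum.inter_filter sum_distrib_left I_def finite_greaterThanLessThan)
  qed simp
  also have "(1 - x) * \<dots> = (\<Sum>a\<in>I. y a * ((1 - x) * (\<Sum>d\<in>{a<..<p}. x ^ d)) + T * y a * ((1 - x) * (\<Sum>d\<in>{0<..<a}. x ^ d)))"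
    by (simp only: sum_distrib_left distrib_left mult.left_commute[of "1 - x"])
  also have "\<dots> = (\<Sum>a\<in>I. y a * (x ^ Suc a - x ^ p) + T * y a * (x - x ^ a))"
    by (intro sum.cong) (auto simp: I_def sum_power_greaterThanLessThan)
  also have "\<dots> = (\<Sum>a\<in>I. (x - T) * (y a * x ^ a) - (x ^ p - T * x) * y a)"
    by (simp add: algebra_simps)
  also have "\<dots> = (x - T) * descent_polylog p v T (Suc r) x - (x ^ p - T * x) * descent_polylog p v T (Suc r) 1"
    by (simp add: sum_subtractf sum_distrib_left y_def I_def)
  finally show ?thesis by (simp only: I_def)
qed

lemma pderiv_descent_sum_cong_0:
  assumes "\<And>a. pderiv (v a) = 0" "pderiv T \<simeq>\<^bsub>p\<^esub> 0"
  shows "pderiv (descent_sum p v T r d :: int poly) \<simeq>\<^bsub>p\<^esub> 0"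
proof (induction r arbitrary: d)
  case (Suc r)
  have s: "pderiv (\<Sum>a\<in>A. v a * descent_sum p v T r a) \<simeq>\<^bsub>p\<^esub> 0" for A
  proof -
    have "pderiv (\<Sum>a\<in>A. v a * descent_sum p v T r a) = (\<Sum>a\<in>A. v a * pderiv (descent_sum p v T r a))"
      by (simp add: pderiv_sum pderiv_mult assms(1))
    also have "\<dots> \<simeq>\<^bsub>p\<^esub> (\<Sum>a\<in>A. v a * 0)"
      by (intro cong_mod_sum cong_mod_mult Suc.IH cong_mod_refl)
    finally show ?thesis by simp
  qed
  show ?case
    using cong_mod_add[OF s cong_mod_add[OF cong_mod_mult[OF cong_mod_refl s] cong_mod_mult[OF cong_mod_refl assms(2)]]]
    by (simp add: pderiv_add pderiv_mult)
qed simp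

lemma pderiv_recip: "pderiv (recip p a) = 0"
  by (simp add: recip_def of_int_poly)

lemma pderiv_weight:
  assumes "pderiv T \<simeq>\<^bsub>p\<^esub> 0"
  shows "pderiv (recip p d * descent_sum p (recip p) T r d :: int poly) \<simeq>\<^bsub>p\<^esub> 0"
  using cong_mod_mult[OF cong_mod_refl pderiv_descent_sum_cong_0[OF pderiv_recip assms], of "recip p d"]
  by (simp add: pderiv_mult pderiv_recip)

text \<open>
  As \<open>T\<close> is constant for the derivation, \<open>x\<close> times the derivative multiplies the term of \<open>x^d\<close> by
  \<open>d\<close>, which cancels the last reciprocal.
\<close>

lemma descent_polylog_differential_equation:
  fixes x T :: "int poly"
  assumes "prime p" "2 ^ r < p" "pderiv T \<simeq>\<^bsub>p\<^esub> 0" "x ^ p \<simeq>\<^bsub>p\<^esub> T" "\<not> of_nat p dvd 1 - T"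
  shows "x * (1 - x) * pderiv (descent_polylog p (recip p) T (Suc r) x)
    \<simeq>\<^bsub>p\<^esub> pderiv x * ((x - T) * descent_polylog p (recip p) T r x)"
proof -
  let ?I = "{0<..<p}"
  let ?U = "descent_sum p (recip p :: nat \<Rightarrow> int poly) T"
  have pos: "0 < p" using assms(1) by (rule prime_gt_0_nat)
  have "x * pderiv (descent_polylog p (recip p) T (Suc r) x)
      = (\<Sum>d\<in>?I. recip p d * (x ^ d * x * pderiv (?U r d) + of_nat d * pderiv x * ?U r d * x ^ d))"
    unfolding descent_polylog.simps pderiv_sum sum_distrib_left
  proof (rule sum.cong)
    fix d assume "d \<in> ?I"
    then obtain e where e: "d = Suc e" by (cases d) auto
    show "x * pderiv (recip p d * ?U r d * x ^ d)
      = recip p d * (x ^ d * x * pderiv (?U r d) + of_nat d * pderiv x * ?U r d * x ^ d)"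
      unfolding e pderiv_mult pderiv_recip pderiv_power_Suc smult_of_nat_eq
      by (simp add: algebra_simps)
  qed simp
  also have "\<dots> = (\<Sum>d\<in>?I. recip p d * x ^ d * x * pderiv (?U r d)
      + (of_nat d * recip p d) * (pderiv x * ?U r d * x ^ d))"
    by (intro sum.cong) (simp_all add: algebra_simps)
  also have "\<dots> \<simeq>\<^bsub>p\<^esub> (\<Sum>d\<in>?I. recip p d * x ^ d * x * 0 + 1 * (pderiv x * ?U r d * x ^ d))"
  proof (rule cong_mod_sum)
    fix d assume "d \<in> ?I"
    then have "of_nat d * recip p d \<simeq>\<^bsub>p\<^esub> (1 :: int poly)"
      using recip_cong[OF assms(1)] by auto
    moreover have "pderiv (?U r d) \<simeq>\<^bsub>p\<^esub> 0"
      by (rule pderiv_descent_sum_cong_0[OF pderiv_recip assms(3)])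
    ultimately show "recip p d * x ^ d * x * pderiv (?U r d)
        + (of_nat d * recip p d) * (pderiv x * ?U r d * x ^ d)
      \<simeq>\<^bsub>p\<^esub> recip p d * x ^ d * x * 0 + 1 * (pderiv x * ?U r d * x ^ d)"
      by (rule cong_mod_add[OF cong_mod_mult[OF cong_mod_refl] cong_mod_mult[OF _ cong_mod_refl], rotated])
  qed
  also have "\<dots> = pderiv x * (\<Sum>d\<in>?I. ?U r d * x ^ d)"
    by (simp add: sum_distrib_left mult.assoc)
  finally have "(1 - x) * (x * pderiv (descent_polylog p (recip p) T (Suc r) x))
      \<simeq>\<^bsub>p\<^esub> (1 - x) * (pderiv x * (\<Sum>d\<in>?I. ?U r d * x ^ d))"
    by (rule cong_mod_mult[OF cong_mod_refl])
  also have "\<dots> = pderiv x * ((1 - x) * (\<Sum>d\<in>?I. ?U r d * x ^ d))"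
    by (rule mult.left_commute)
  also have "\<dots> \<simeq>\<^bsub>p\<^esub> pderiv x * ((x - T) * descent_polylog p (recip p) T r x)"
  proof (rule cong_mod_mult[OF cong_mod_refl])
    show "(1 - x) * (\<Sum>d\<in>?I. ?U r d * x ^ d) \<simeq>\<^bsub>p\<^esub> (x - T) * descent_polylog p (recip p) T r x"
    proof (cases r)
      case 0
      have "(1 - x) * (\<Sum>d\<in>?I. ?U r d * x ^ d) = x - x ^ p"
        using sum_power_greaterThanLessThan[OF pos, of x] 0 by simp
      also have "\<dots> \<simeq>\<^bsub>p\<^esub> x - T"
        by (intro cong_mod_diff cong_mod_refl assms(4))
      finally show ?thesis using 0 by simp
    next
      case (Suc s)
      have "descent_polylog p (recip p) T r 1 \<simeq>\<^bsub>p\<^esub> 0"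
        using assms Suc by (intro descent_polylog_at_1_cong_0) auto
      from cong_mod_diff[OF cong_mod_refl cong_mod_mult[OF cong_mod_refl this],
          of "(x - T) * descent_polylog p (recip p) T r x" "x ^ p - T * x"]
      show ?thesis
        unfolding Suc descent_sum_generating_function[OF pos] by simp
    qed
  qed
  finally show ?thesis by (simp only: mult_ac)
qed

text \<open>
  This is a condition modulo \<open>p\<close>. It complements the kernel of the derivation modulo \<open>p\<close>, which
  consists of the polynomials in \<open>t^p\<close>, and it is stable under multiplication by this kernel.
\<close>

definition no_pth_power_terms :: "nat \<Rightarrow> int poly \<Rightarrow> bool" where
  "no_pth_power_terms p f \<longleftrightarrow> (\<forall>n. p dvd n \<longrightarrow> int p dvd coeff f n)"

lemma no_pth_power_terms_sum:
  "(\<And>i. i \<in> A \<Longrightarrow> no_pth_power_terms p (f i)) \<Longrightarrow> no_pth_power_terms p (sum f A)"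
  unfolding no_pth_power_terms_def by (auto simp: coeff_sum intro!: dvd_sum)

lemma no_pth_power_terms_diff:
  "no_pth_power_terms p f \<Longrightarrow> no_pth_power_terms p g \<Longrightarrow> no_pth_power_terms p (f - g)"
  unfolding no_pth_power_terms_def by auto

lemma no_pth_power_terms_cong:
  "f \<simeq>\<^bsub>p\<^esub> g \<Longrightarrow> no_pth_power_terms p f \<Longrightarrow> no_pth_power_terms p g"
  unfolding no_pth_power_terms_def cong_mod_def of_nat_dvd_int_poly_iff
  by (metis coeff_diff dvd_diff_right_iff)

lemma coeff_dvd_of_pderiv_cong_0:
  assumes "prime p" "pderiv c \<simeq>\<^bsub>p\<^esub> 0" "\<not> p dvd n"
  shows "int p dvd coeff c n"
proof -
  obtain m where m: "n = Suc m" using assms(3) by (cases n) auto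
  have "int p dvd int n * coeff c n"
    using assms(2) by (auto simp: cong_mod_def of_nat_dvd_int_poly_iff coeff_pderiv m dest: spec[of _ m])
  then show ?thesis
    using assms(1,3) by (simp add: prime_dvd_mult_iff)
qed

lemma no_pth_power_terms_mult:
  assumes "prime p" "pderiv c \<simeq>\<^bsub>p\<^esub> 0" "no_pth_power_terms p f"
  shows "no_pth_power_terms p (c * f)"
  unfolding no_pth_power_terms_def coeff_mult
proof (intro allI impI dvd_sum)
  fix n i assume "p dvd n" "i \<in> {..n}"
  then show "int p dvd coeff c i * coeff f (n - i)"
    using coeff_dvd_of_pderiv_cong_0[OF assms(1,2), of i] assms(3)
    by (cases "p dvd i") (auto simp: no_pth_power_terms_def)
qed

lemma cong_0_of_pderiv_cong_0:
  assumes "prime p" "pderiv f \<simeq>\<^bsub>p\<^esub> 0" "no_pth_power_terms p f"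
  shows "f \<simeq>\<^bsub>p\<^esub> 0"
  using assms coeff_dvd_of_pderiv_cong_0[OF assms(1,2)]
  by (auto simp: cong_mod_def of_nat_dvd_int_poly_iff no_pth_power_terms_def)

text \<open>
  Both sides satisfy the same differential equation, because \<open>t - t^p\<close> changes its sign under
  \<open>t \<mapsto> 1 - t\<close> (modulo \<open>p\<close>) and so does the derivative of the argument.
\<close>

theorem descent_polylog_reflection:
  fixes t :: "int poly"
  defines "t \<equiv> [:0, 1:]"
  assumes "prime p" "2 ^ r < p"
  shows "descent_polylog p (recip p) (t ^ p) r t
    \<simeq>\<^bsub>p\<^esub> descent_polylog p (recip p) (1 - t ^ p) r (1 - t)"
  using assms(3)
proof (induction r)
  case (Suc r)
  let ?F = "descent_polylog p (recip p) (t ^ p)"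
  let ?H = "descent_polylog p (recip p) (1 - t ^ p)"
  have "1 \<le> (2 :: nat) ^ r" by simp
  have "p > 2"
    using Suc.prems \<open>1 \<le> 2 ^ r\<close> unfolding power_Suc by linarith
  with assms(2) have "odd p" by (simp add: prime_odd_nat)
  have r: "2 ^ r < p" using Suc.prems by simp
  have mon: "t ^ n = monom 1 n" for n
    by (simp add: t_def monom_altdef)
  have dt: "pderiv (t ^ p) \<simeq>\<^bsub>p\<^esub> 0"
    unfolding mon cong_mod_def of_nat_dvd_int_poly_iff by (simp add: pderiv_monom)
  then have dt': "pderiv (1 - t ^ p) \<simeq>\<^bsub>p\<^esub> 0"
    using cong_mod_diff[OF cong_mod_refl dt, of 0] by (simp add: pderiv_diff)
  have ndvd: "\<not> of_nat p dvd t" "\<not> of_nat p dvd 1 - t" "\<not> of_nat p dvd t ^ p" "\<not> of_nat p dvd 1 - t ^ p"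
  proof -
    have 1: "\<not> int p dvd 1" using \<open>p > 2\<close> by simp
    have "\<not> of_nat p dvd f" if "coeff f n = 1" for f :: "int poly" and n
      using that 1 by (auto simp: of_nat_dvd_int_poly_iff intro!: exI[of _ n])
    from this[of t 1] this[of "1 - t" 0] this[of "t ^ p" p] this[of "1 - t ^ p" 0] show
      "\<not> of_nat p dvd t" "\<not> of_nat p dvd 1 - t" "\<not> of_nat p dvd t ^ p" "\<not> of_nat p dvd 1 - t ^ p"
      using \<open>p > 2\<close> by (simp_all add: mon) (simp_all add: t_def)
  qed
  have "t * (1 - t) * pderiv (?F (Suc r) t) \<simeq>\<^bsub>p\<^esub> (t - t ^ p) * ?F r t"
    using descent_polylog_differential_equation[OF assms(2) r dt cong_mod_refl ndvd(4)]
    by (simp add: t_def pderiv_pCons)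
  also have "\<dots> \<simeq>\<^bsub>p\<^esub> (t - t ^ p) * ?H r (1 - t)"
    by (intro cong_mod_mult cong_mod_refl Suc.IH r)
  also have "\<dots> = pderiv (1 - t) * ((1 - t - (1 - t ^ p)) * ?H r (1 - t))"
    by (simp add: t_def pderiv_pCons pderiv_diff algebra_simps)
  also have "\<dots> \<simeq>\<^bsub>p\<^esub> (1 - t) * (1 - (1 - t)) * pderiv (?H (Suc r) (1 - t))"
    using ndvd assms(2) \<open>odd p\<close> by (intro cong_mod_sym[OF descent_polylog_differential_equation]
      freshmans_dream_one_minus r dt') auto
  finally have "t * (1 - t) * pderiv (?F (Suc r) t) \<simeq>\<^bsub>p\<^esub> t * (1 - t) * pderiv (?H (Suc r) (1 - t))"
    by (simp add: mult.commute)
  moreover have "\<not> of_nat p dvd t * (1 - t)"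
    using ndvd cong_mod_cancel[OF assms(2), of t "1 - t" 0] by (auto simp: cong_mod_def)
  ultimately have "pderiv (?F (Suc r) t) \<simeq>\<^bsub>p\<^esub> pderiv (?H (Suc r) (1 - t))"
    using cong_mod_cancel[OF assms(2)] by blast
  then have "pderiv (?F (Suc r) t - ?H (Suc r) (1 - t)) \<simeq>\<^bsub>p\<^esub> 0"
    by (simp add: cong_mod_def pderiv_diff)
  moreover have "no_pth_power_terms p (?F (Suc r) t)"
  proof -
    have "no_pth_power_terms p (t ^ d)" if "d \<in> {0<..<p}" for d
      using that by (auto simp: mon no_pth_power_terms_def dest: nat_dvd_not_less)
    then show ?thesis
      unfolding descent_polylog.simps using assms(2) dt
      by (intro no_pth_power_terms_sum no_pth_power_terms_mult pderiv_weight)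
  qed
  moreover have "no_pth_power_terms p (?H (Suc r) (1 - t))"
  proof -
    have "no_pth_power_terms p ((1 - t) ^ d - 1)" if d: "d \<in> {0<..<p}" for d
      unfolding no_pth_power_terms_def
    proof (intro allI impI)
      fix n assume "p dvd n"
      show "int p dvd coeff ((1 - t) ^ d - 1) n"
      proof (cases "n = 0")
        case True
        then show ?thesis
          by (simp add: coeff_0_power t_def)
      next
        case False
        with \<open>p dvd n\<close> d have "d < n" by (auto dest: dvd_imp_le)
        moreover have "degree ((1 - t) ^ d) \<le> d"
          using degree_power_le[of "1 - t" d] by (simp add: t_def one_pCons)
        ultimately show ?thesis
          using False by (simp add: coeff_eq_0)
      qed
    qed
    then have "no_pth_power_terms p (\<Sum>d\<in>{0<..<p}. recip p d * descent_sum p (recip p) (1 - t ^ p) r d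
        * ((1 - t) ^ d - 1))"
      using assms(2) dt'
      by (intro no_pth_power_terms_sum no_pth_power_terms_mult pderiv_weight)
    then have "no_pth_power_terms p (?H (Suc r) (1 - t) - ?H (Suc r) 1)"
      by (simp add: sum_subtractf right_diff_distrib)
    \<comment> \<open>Subtracting the value at \<open>1\<close>, which is zero modulo \<open>p\<close>, replaces each \<open>(1 - t)^d\<close> by
      \<open>(1 - t)^d - 1\<close> and so removes its constant term.\<close>
    moreover have "?H (Suc r) (1 - t) - ?H (Suc r) 1 \<simeq>\<^bsub>p\<^esub> ?H (Suc r) (1 - t) - 0"
      using ndvd assms(2) Suc.prems by (intro cong_mod_diff cong_mod_refl descent_polylog_at_1_cong_0) auto
    ultimately show ?thesis
      using no_pth_power_terms_cong by fastforce
  qed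
  ultimately have "?F (Suc r) t - ?H (Suc r) (1 - t) \<simeq>\<^bsub>p\<^esub> 0"
    by (metis cong_0_of_pderiv_cong_0[OF assms(2)] no_pth_power_terms_diff)
  then show ?case by (simp add: cong_mod_def)
qed simp


section \<open>Expansion in depth four\<close>

definition polylog_sum :: "nat \<Rightarrow> (nat \<Rightarrow> 'a::comm_ring_1) \<Rightarrow> nat list \<Rightarrow> 'a list \<Rightarrow> 'a" where
  "polylog_sum p v ks xs = (\<Sum>ns | length ns = length ks \<and> sorted_wrt (<) ns \<and> set ns \<subseteq> {0<..<p}.
     \<Prod>i<length ks. v (ns ! i) ^ (ks ! i) * xs ! i ^ (ns ! i))"

lemma sum_lists_Suc:
  assumes "finite A"
  shows "(\<Sum>ns | set ns \<subseteq> A \<and> length ns = Suc n. g ns)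
    = (\<Sum>a\<in>A. \<Sum>ns | set ns \<subseteq> A \<and> length ns = n. g (a # ns))"
proof -
  have "(\<Sum>ns | set ns \<subseteq> A \<and> length ns = Suc n. g ns)
      = (\<Sum>(ns, a)\<in>{ns. set ns \<subseteq> A \<and> length ns = n} \<times> A. g (a # ns))"
    unfolding lists_length_Suc_eq by (subst sum.reindex) (auto simp: inj_on_def split_def)
  also have "\<dots> = (\<Sum>a\<in>A. \<Sum>ns | set ns \<subseteq> A \<and> length ns = n. g (a # ns))"
    by (subst sum.cartesian_product[symmetric], rule sum.swap)
  finally show ?thesis .
qed

lemma sum_lists_0: "(\<Sum>ns | set ns \<subseteq> A \<and> length ns = 0. g ns) = g []"
proof -
  have "{ns. set ns \<subseteq> A \<and> length ns = 0} = {[]}" by auto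
  then show ?thesis by simp
qed

text \<open>
  Unrestricted lists with the order condition as a factor split off their entries one by one, each
  running over the same set; so the resulting nested sums can be interchanged freely.
\<close>

lemma polylog_sum_lists:
  "polylog_sum p v ks xs = (\<Sum>ns | set ns \<subseteq> {0<..<p} \<and> length ns = length ks.
     of_bool (sorted_wrt (<) ns) * (\<Prod>i<length ks. v (ns ! i) ^ (ks ! i) * xs ! i ^ (ns ! i)))"
  unfolding polylog_sum_def
  by (rule sum.mono_neutral_cong_left) (auto simp: finite_lists_length_eq)

lemma polylog_sum_4:
  "polylog_sum p v [k1, k2, k3, k4] [x1, x2, x3, x4] = (\<Sum>a\<in>{0<..<p}. \<Sum>b\<in>{0<..<p}. \<Sum>c\<in>{0<..<p}. \<Sum>d\<in>{0<..<p}.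
     of_bool (a < b \<and> b < c \<and> c < d) * ((v a ^ k1 * x1 ^ a) * (v b ^ k2 * x2 ^ b) * (v c ^ k3 * x3 ^ c) * (v d ^ k4 * x4 ^ d)))"
proof -
  have len: "length [k1, k2, k3, k4] = Suc (Suc (Suc (Suc 0)))" by simp
  show ?thesis
    unfolding polylog_sum_lists len sum_lists_Suc[OF finite_greaterThanLessThan] sum_lists_0
    by (intro sum.cong refl) (auto simp: lessThan_Suc mult_ac)
qed

lemma polylog_sum_3:
  "polylog_sum p v [k1, k2, k3] [x1, x2, x3] = (\<Sum>a\<in>{0<..<p}. \<Sum>b\<in>{0<..<p}. \<Sum>c\<in>{0<..<p}.
     of_bool (a < b \<and> b < c) * ((v a ^ k1 * x1 ^ a) * (v b ^ k2 * x2 ^ b) * (v c ^ k3 * x3 ^ c)))"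
proof -
  have len: "length [k1, k2, k3] = Suc (Suc (Suc 0))" by simp
  show ?thesis
    unfolding polylog_sum_lists len sum_lists_Suc[OF finite_greaterThanLessThan] sum_lists_0
    by (intro sum.cong refl) (auto simp: lessThan_Suc mult_ac)
qed

lemma polylog_sum_2:
  "polylog_sum p v [k1, k2] [x1, x2] = (\<Sum>a\<in>{0<..<p}. \<Sum>b\<in>{0<..<p}.
     of_bool (a < b) * ((v a ^ k1 * x1 ^ a) * (v b ^ k2 * x2 ^ b)))"
proof -
  have len: "length [k1, k2] = Suc (Suc 0)" by simp
  show ?thesis
    unfolding polylog_sum_lists len sum_lists_Suc[OF finite_greaterThanLessThan] sum_lists_0
    by (intro sum.cong refl) (auto simp: lessThan_Suc mult_ac)
qed

definition sum_pairs :: "nat set \<Rightarrow> (nat \<Rightarrow> nat \<Rightarrow> 'a::comm_ring_1) \<Rightarrow> 'a" where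
  "sum_pairs I f = (\<Sum>a\<in>I. \<Sum>b\<in>I. of_bool (a < b) * f a b)"

definition sum_triples :: "nat set \<Rightarrow> (nat \<Rightarrow> nat \<Rightarrow> nat \<Rightarrow> 'a::comm_ring_1) \<Rightarrow> 'a" where
  "sum_triples I f = (\<Sum>a\<in>I. \<Sum>b\<in>I. \<Sum>c\<in>I. of_bool (a < b \<and> b < c) * f a b c)"

lemma sum_pairs_add: "sum_pairs I (\<lambda>a b. f a b + g a b) = sum_pairs I f + sum_pairs I g"
  by (simp add: sum_pairs_def distrib_left sum.distrib)

lemma sum_triples_add:
  "sum_triples I (\<lambda>a b c. f a b c + g a b c) = sum_triples I f + sum_triples I g"
  by (simp add: sum_triples_def distrib_left sum.distrib)

lemma sum_pairs_mult: "sum_pairs I (\<lambda>a b. k * f a b) = k * sum_pairs I f"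
  by (simp add: sum_pairs_def sum_distrib_left mult.left_commute)

lemma sum_triples_mult: "sum_triples I (\<lambda>a b c. k * f a b c) = k * sum_triples I f"
  by (simp add: sum_triples_def sum_distrib_left mult.left_commute)

lemma sum_pairs_cong:
  "(\<And>a b. a < b \<Longrightarrow> f a b = g a b) \<Longrightarrow> sum_pairs I f = sum_pairs I g"
  unfolding sum_pairs_def by (intro sum.cong refl) (auto simp: of_bool_def)

lemma sum_triples_cong:
  "(\<And>a b c. a < b \<Longrightarrow> b < c \<Longrightarrow> f a b c = g a b c) \<Longrightarrow> sum_triples I f = sum_triples I g"
  unfolding sum_triples_def by (intro sum.cong refl) (auto simp: of_bool_def)

lemma sum_of_bool_eq:
  assumes "finite I" "d \<in> I"
  shows "(\<Sum>a\<in>I. of_bool (P a) * (of_bool (d = a) * f a)) = of_bool (P d) * (f d :: 'a::comm_ring_1)"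
proof -
  have "(\<Sum>a\<in>I. of_bool (P a) * (of_bool (d = a) * f a)) = (\<Sum>a\<in>I. if a = d then of_bool (P a) * f a else 0)"
    by (rule sum.cong) auto
  then show ?thesis using assms by simp
qed

text \<open>
  A triple whose neighbours differ either has three different entries, which are put into increasing
  order by one of six permutations, or has the form \<open>a b a\<close>.
\<close>

lemma sum_all_triples:
  fixes h :: "nat \<Rightarrow> nat \<Rightarrow> nat \<Rightarrow> 'a::comm_ring_1"
  assumes "finite I" "\<And>a c. h a a c = 0" "\<And>a c. h a c c = 0"
  shows "(\<Sum>a\<in>I. \<Sum>b\<in>I. \<Sum>c\<in>I. h a b c)
    = sum_triples I (\<lambda>a b c. h a b c + h a c b + h b a c + h b c a + h c a b + h c b a)
      + sum_pairs I (\<lambda>a b. h a b a + h b a b)"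
proof -
  define S where "S g = (\<Sum>a\<in>I. \<Sum>b\<in>I. \<Sum>c\<in>I. g a b c)" for g :: "nat \<Rightarrow> nat \<Rightarrow> nat \<Rightarrow> 'a"
  let ?o = "\<lambda>a b c. of_bool (a < b \<and> b < c) :: 'a"
  have S_add: "S (\<lambda>a b c. f a b c + g a b c) = S f + S g" for f g
    by (simp add: S_def sum.distrib)
  have swap12: "S (\<lambda>a b c. g a b c) = S (\<lambda>a b c. g b a c)" for g
    unfolding S_def by (rule sum.swap)
  have swap23: "S (\<lambda>a b c. g a b c) = S (\<lambda>a b c. g a c b)" for g
    unfolding S_def by (intro sum.cong refl sum.swap)
  have perms:
    "S (\<lambda>a b c. ?o a c b * h a b c) = S (\<lambda>a b c. ?o a b c * h a c b)"
    "S (\<lambda>a b c. ?o b a c * h a b c) = S (\<lambda>a b c. ?o a b c * h b a c)"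
    "S (\<lambda>a b c. ?o c a b * h a b c) = S (\<lambda>a b c. ?o a b c * h b c a)"
    "S (\<lambda>a b c. ?o b c a * h a b c) = S (\<lambda>a b c. ?o a b c * h c a b)"
    "S (\<lambda>a b c. ?o c b a * h a b c) = S (\<lambda>a b c. ?o a b c * h c b a)"
  proof -
    show "S (\<lambda>a b c. ?o a c b * h a b c) = S (\<lambda>a b c. ?o a b c * h a c b)"
      by (rule swap23)
    show "S (\<lambda>a b c. ?o b a c * h a b c) = S (\<lambda>a b c. ?o a b c * h b a c)"
      by (rule swap12)
    have "S (\<lambda>a b c. ?o c a b * h a b c) = S (\<lambda>a b c. ?o b a c * h a c b)"
      by (rule swap23)
    also have "\<dots> = S (\<lambda>a b c. ?o a b c * h b c a)"
      by (rule swap12)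
    finally show "S (\<lambda>a b c. ?o c a b * h a b c) = S (\<lambda>a b c. ?o a b c * h b c a)" .
    have "S (\<lambda>a b c. ?o b c a * h a b c) = S (\<lambda>a b c. ?o a c b * h b a c)"
      by (rule swap12)
    also have "\<dots> = S (\<lambda>a b c. ?o a b c * h c a b)"
      by (rule swap23)
    finally show "S (\<lambda>a b c. ?o b c a * h a b c) = S (\<lambda>a b c. ?o a b c * h c a b)" .
    have "S (\<lambda>a b c. ?o c b a * h a b c) = S (\<lambda>a b c. ?o c a b * h b a c)"
      by (rule swap12)
    also have "\<dots> = S (\<lambda>a b c. ?o b a c * h c a b)"
      by (rule swap23)
    also have "\<dots> = S (\<lambda>a b c. ?o a b c * h c b a)"
      by (rule swap12)
    finally show "S (\<lambda>a b c. ?o c b a * h a b c) = S (\<lambda>a b c. ?o a b c * h c b a)" .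
  qed
  have delta: "S (\<lambda>a b c. of_bool (P a b) * (of_bool (a = c) * h a b c)) 
      = (\<Sum>a\<in>I. \<Sum>b\<in>I. of_bool (P a b) * h a b a)" for P
    unfolding S_def by (intro sum.cong refl sum_of_bool_eq[OF assms(1)])
  have "S h = S (\<lambda>a b c. ?o a b c * h a b c + ?o a c b * h a b c + ?o b a c * h a b c
      + ?o c a b * h a b c + ?o b c a * h a b c + ?o c b a * h a b c
      + of_bool (a < b) * (of_bool (a = c) * h a b c) + of_bool (b < a) * (of_bool (a = c) * h a b c))"
    (is "_ = S ?rhs")
  proof -
    have "h a b c = ?rhs a b c" for a b c
    proof -
      consider "a = b" | "b = c" | "a = c" "a < b" | "a = c" "b < a"
        | "a < b" "b < c" | "a < c" "c < b" | "b < a" "a < c" | "c < a" "a < b"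
        | "b < c" "c < a" | "c < b" "b < a" by linarith
      then show ?thesis using assms(2,3) by cases auto
    qed
    then show ?thesis by (simp only: S_def)
  qed
  also have "\<dots> = sum_triples I (\<lambda>a b c. h a b c + h a c b + h b a c + h b c a + h c a b + h c b a)
      + ((\<Sum>a\<in>I. \<Sum>b\<in>I. of_bool (a < b) * h a b a) + (\<Sum>a\<in>I. \<Sum>b\<in>I. of_bool (b < a) * h a b a))"
    unfolding S_add perms delta by (simp only: sum_triples_add) (simp only: sum_triples_def S_def add_ac)
  also have "(\<Sum>a\<in>I. \<Sum>b\<in>I. of_bool (b < a) * h a b a) = (\<Sum>a\<in>I. \<Sum>b\<in>I. of_bool (a < b) * h b a b)"
    by (rule sum.swap)
  finally show ?thesis
    by (simp add: S_def sum_pairs_def distrib_left sum.distrib)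
qed

lemma descent_sum_Suc_of_bool:
  fixes v :: "nat \<Rightarrow> 'a::comm_ring_1"
  assumes "d \<in> {0<..<p}"
  shows "descent_sum p v T (Suc r) d
    = (\<Sum>a\<in>{0<..<p}. (of_bool (a < d) + T * of_bool (d < a)) * (v a * descent_sum p v T r a))"
proof -
  have *: "sum g {0<..<d} = (\<Sum>a\<in>{0<..<p}. of_bool (a < d) * g a)"
    "sum g {d<..<p} = (\<Sum>a\<in>{0<..<p}. of_bool (d < a) * g a)" for g :: "nat \<Rightarrow> 'a"
    using assms by (intro sum.mono_neutral_cong_left; auto)+
  show ?thesis
    by (simp only: descent_sum.simps * distrib_right sum.distrib sum_distrib_left mult.assoc)
qed

text \<open>
  The coefficients count descents. For \<open>a < b < c\<close> and \<open>d\<close> in a given position relative to them, the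
  first seven coefficients are the sums of \<open>T\<close> to the number of descents over all arrangements of
  \<open>a, b, c\<close> in front of \<open>d\<close> whose last entry is not \<open>d\<close>. For \<open>a < b\<close>, the remaining ones belong to
  the sequences \<open>a b a d\<close> and \<open>b a b d\<close>, which have one descent before the last step.
\<close>

lemma descent_sum_3:
  fixes v :: "nat \<Rightarrow> 'a::comm_ring_1"
  assumes d: "d \<in> {0<..<p}"
  defines "I \<equiv> {0<..<p}"
  shows "descent_sum p v T 3 d =
      (1 + 4 * T + T^2) * sum_triples I (\<lambda>a b c. of_bool (c < d) * (v a * v b * v c))
    + 2 * T * (2 + T) * sum_triples I (\<lambda>a b c. of_bool (b < d \<and> d < c) * (v a * v b * v c))
    + 2 * T * (1 + 2 * T) * sum_triples I (\<lambda>a b c. of_bool (a < d \<and> d < b) * (v a * v b * v c))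
    + T * (1 + 4 * T + T^2) * sum_triples I (\<lambda>a b c. of_bool (d < a) * (v a * v b * v c))
    + T * (1 + 3 * T) * sum_triples I (\<lambda>a b c. of_bool (d = a) * (v a * v b * v c))
    + 2 * T * (1 + T) * sum_triples I (\<lambda>a b c. of_bool (d = b) * (v a * v b * v c))
    + T * (3 + T) * sum_triples I (\<lambda>a b c. of_bool (d = c) * (v a * v b * v c))
    + (T * sum_pairs I (\<lambda>a b. of_bool (b < d) * (v a ^ 2 * v b))
      + T * sum_pairs I (\<lambda>a b. of_bool (a < d \<and> d < b) * (v a ^ 2 * v b))
      + T * sum_pairs I (\<lambda>a b. of_bool (b < d) * (v a * v b ^ 2))
      + T * sum_pairs I (\<lambda>a b. of_bool (d = b) * (v a ^ 2 * v b))
      + T^2 * sum_pairs I (\<lambda>a b. of_bool (d < a) * (v a * v b ^ 2))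
      + T^2 * sum_pairs I (\<lambda>a b. of_bool (a < d \<and> d < b) * (v a * v b ^ 2))
      + T^2 * sum_pairs I (\<lambda>a b. of_bool (d < a) * (v a ^ 2 * v b))
      + T^2 * sum_pairs I (\<lambda>a b. of_bool (d = a) * (v a * v b ^ 2)))"
proof -
  define e where "e a b = of_bool (a < b) + T * of_bool (b < a)" for a b :: nat
  have e_simps: "a < b \<Longrightarrow> e a b = 1" "b < a \<Longrightarrow> e a b = T" "e a a = 0" for a b
    by (simp_all add: e_def)
  \<comment> \<open>The arguments of \<open>h\<close> are in the order of the nested sums, last entry of the sequence first.\<close>
  define h where "h c b a = e c d * e b c * e a b * (v a * v b * v c)" for a b c
  have step: "descent_sum p v T (Suc r) x = (\<Sum>a\<in>I. e a x * (v a * descent_sum p v T r a))"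
    if "x \<in> I" for x r
    using that unfolding I_def e_def by (rule descent_sum_Suc_of_bool)
  have "descent_sum p v T 3 d = (\<Sum>c\<in>I. e c d * (v c * (\<Sum>b\<in>I. e b c * (v b * (\<Sum>a\<in>I. e a b * v a)))))"
    using d by (simp add: numeral_3_eq_3 step I_def[symmetric] del: descent_sum.simps(2) cong: sum.cong)
  also have "\<dots> = (\<Sum>c\<in>I. \<Sum>b\<in>I. \<Sum>a\<in>I. h c b a)"
    unfolding sum_distrib_left h_def by (intro sum.cong refl) (simp only: mult_ac)
  also have "\<dots> = sum_triples I (\<lambda>a b c. h a b c + h a c b + h b a c + h b c a + h c a b + h c b a)
      + sum_pairs I (\<lambda>a b. h a b a + h b a b)"
    by (rule sum_all_triples) (auto simp: I_def h_def e_simps)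
  also have "sum_triples I (\<lambda>a b c. h a b c + h a c b + h b a c + h b c a + h c a b + h c b a)
    = sum_triples I (\<lambda>a b c. 
      (1 + 4 * T + T^2) * (of_bool (c < d) * (v a * v b * v c))
    + 2 * T * (2 + T) * (of_bool (b < d \<and> d < c) * (v a * v b * v c))
    + 2 * T * (1 + 2 * T) * (of_bool (a < d \<and> d < b) * (v a * v b * v c))
    + T * (1 + 4 * T + T^2) * (of_bool (d < a) * (v a * v b * v c))
    + T * (1 + 3 * T) * (of_bool (d = a) * (v a * v b * v c))
    + 2 * T * (1 + T) * (of_bool (d = b) * (v a * v b * v c))
    + T * (3 + T) * (of_bool (d = c) * (v a * v b * v c)))"
    (is "_ = sum_triples I ?f3")
  proof (rule sum_triples_cong)
    fix a b c :: nat assume abc: "a < b" "b < c"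
    then have "a < c" by simp
    consider "d < a" | "d = a" | "a < d" "d < b" | "d = b" | "b < d" "d < c" | "d = c" | "c < d"
      by linarith
    then show "h a b c + h a c b + h b a c + h b c a + h c a b + h c b a = ?f3 a b c"
      using abc \<open>a < c\<close>
      by cases (simp_all add: h_def e_simps, simp_all add: algebra_simps power2_eq_square)
  qed
  also have "sum_pairs I (\<lambda>a b. h a b a + h b a b) = sum_pairs I (\<lambda>a b. 
        T * (of_bool (b < d) * (v a ^ 2 * v b))
      + T * (of_bool (a < d \<and> d < b) * (v a ^ 2 * v b))
      + T * (of_bool (b < d) * (v a * v b ^ 2))
      + T * (of_bool (d = b) * (v a ^ 2 * v b))
      + T^2 * (of_bool (d < a) * (v a * v b ^ 2))
      + T^2 * (of_bool (a < d \<and> d < b) * (v a * v b ^ 2))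
      + T^2 * (of_bool (d < a) * (v a ^ 2 * v b))
      + T^2 * (of_bool (d = a) * (v a * v b ^ 2)))"
    (is "_ = sum_pairs I ?f2")
  proof (rule sum_pairs_cong)
    fix a b :: nat assume ab: "a < b"
    consider "d < a" | "d = a" | "a < d" "d < b" | "d = b" | "b < d"
      by linarith
    then show "h a b a + h b a b = ?f2 a b"
      using ab
      by cases (simp_all add: h_def e_simps, simp_all add: algebra_simps power2_eq_square)
  qed
  finally show ?thesis
    unfolding sum_triples_add sum_triples_mult sum_pairs_add sum_pairs_mult .
qed

lemma sum_swap_3: "(\<Sum>a\<in>A. \<Sum>b\<in>B. \<Sum>d\<in>D. f a b d) = (\<Sum>d\<in>D. \<Sum>a\<in>A. \<Sum>b\<in>B. f a b d)"
proof -
  have "(\<Sum>a\<in>A. \<Sum>b\<in>B. \<Sum>d\<in>D. f a b d) = (\<Sum>a\<in>A. \<Sum>d\<in>D. \<Sum>b\<in>B. f a b d)"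
    by (intro sum.cong refl sum.swap)
  also have "\<dots> = (\<Sum>d\<in>D. \<Sum>a\<in>A. \<Sum>b\<in>B. f a b d)"
    by (rule sum.swap)
  finally show ?thesis .
qed

lemma sum_swap_4:
  "(\<Sum>a\<in>A. \<Sum>b\<in>B. \<Sum>c\<in>C. \<Sum>d\<in>D. f a b c d) = (\<Sum>d\<in>D. \<Sum>a\<in>A. \<Sum>b\<in>B. \<Sum>c\<in>C. f a b c d)"
proof -
  have "(\<Sum>a\<in>A. \<Sum>b\<in>B. \<Sum>c\<in>C. \<Sum>d\<in>D. f a b c d) = (\<Sum>a\<in>A. \<Sum>d\<in>D. \<Sum>b\<in>B. \<Sum>c\<in>C. f a b c d)"
    by (intro sum.cong refl sum_swap_3)
  also have "\<dots> = (\<Sum>d\<in>D. \<Sum>a\<in>A. \<Sum>b\<in>B. \<Sum>c\<in>C. f a b c d)"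
    by (rule sum.swap)
  finally show ?thesis .
qed

lemma sum_triples_eq:
  assumes "finite I" "d \<in> I"
  shows "sum_triples I (\<lambda>a b c. of_bool (d = a) * f a b c) = (\<Sum>b\<in>I. \<Sum>c\<in>I. of_bool (d < b \<and> b < c) * f d b c)"
    "sum_triples I (\<lambda>a b c. of_bool (d = b) * f a b c) = (\<Sum>a\<in>I. \<Sum>c\<in>I. of_bool (a < d \<and> d < c) * f a d c)"
    "sum_triples I (\<lambda>a b c. of_bool (d = c) * f a b c) = (\<Sum>a\<in>I. \<Sum>b\<in>I. of_bool (a < b \<and> b < d) * f a b d)"
    "sum_pairs I (\<lambda>a b. of_bool (d = a) * g a b) = (\<Sum>b\<in>I. of_bool (d < b) * g d b)"
    "sum_pairs I (\<lambda>a b. of_bool (d = b) * g a b) = (\<Sum>a\<in>I. of_bool (a < d) * g a d)"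
proof -
  show "sum_triples I (\<lambda>a b c. of_bool (d = a) * f a b c) = (\<Sum>b\<in>I. \<Sum>c\<in>I. of_bool (d < b \<and> b < c) * f d b c)"
    unfolding sum_triples_def
    by (subst sum_swap_3[symmetric], simp only: sum_of_bool_eq[OF assms])
  show "sum_triples I (\<lambda>a b c. of_bool (d = b) * f a b c) = (\<Sum>a\<in>I. \<Sum>c\<in>I. of_bool (a < d \<and> d < c) * f a d c)"
    unfolding sum_triples_def
    by (rule sum.cong[OF refl], subst sum.swap, simp only: sum_of_bool_eq[OF assms])
  show "sum_triples I (\<lambda>a b c. of_bool (d = c) * f a b c) = (\<Sum>a\<in>I. \<Sum>b\<in>I. of_bool (a < b \<and> b < d) * f a b d)"
    unfolding sum_triples_def by (simp only: sum_of_bool_eq[OF assms])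
  show "sum_pairs I (\<lambda>a b. of_bool (d = a) * g a b) = (\<Sum>b\<in>I. of_bool (d < b) * g d b)"
    unfolding sum_pairs_def by (subst sum.swap, simp only: sum_of_bool_eq[OF assms])
  show "sum_pairs I (\<lambda>a b. of_bool (d = b) * g a b) = (\<Sum>a\<in>I. of_bool (a < d) * g a d)"
    unfolding sum_pairs_def by (simp only: sum_of_bool_eq[OF assms])
qed

text \<open>
  Each polylogarithm on the right has one variable different from \<open>1\<close>. Moving the summation index
  \<open>d\<close> of this variable to the front makes it a sum over \<open>d\<close> of \<open>v d x^d\<close> times one of the fifteen sums
  over triples or pairs in the expansion of the descent sum of depth \<open>3\<close>. If the exponent at \<open>d\<close> is
  \<open>2\<close>, the extra factor \<open>v d\<close> comes from an entry of the triple or pair equal to \<open>d\<close>.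
\<close>

lemma descent_polylog_4:
  fixes p :: nat and v :: "nat \<Rightarrow> 'a::comm_ring_1"
  defines "P \<equiv> polylog_sum p v"
  shows "descent_polylog p v T 4 x =
      (1 + 4 * T + T^2) * P [1,1,1,1] [1,1,1,x]
    + 2 * T * (2 + T) * P [1,1,1,1] [1,1,x,1]
    + 2 * T * (1 + 2 * T) * P [1,1,1,1] [1,x,1,1]
    + T * (1 + 4 * T + T^2) * P [1,1,1,1] [x,1,1,1]
    + T * (1 + 3 * T) * P [2,1,1] [x,1,1]
    + 2 * T * (1 + T) * P [1,2,1] [1,x,1]
    + T * (3 + T) * P [1,1,2] [1,1,x]
    + T * (P [2,1,1] [1,1,x] + P [2,1,1] [1,x,1] + P [1,2,1] [1,1,x] + P [2,2] [1,x])
    + T^2 * (P [1,1,2] [x,1,1] + P [1,1,2] [1,x,1] + P [1,2,1] [x,1,1] + P [2,2] [x,1])"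
proof -
  define I where "I = {0<..<p}"
  have fin: "finite I" by (simp add: I_def)
  note nested = P_def polylog_sum_4 polylog_sum_3 polylog_sum_2 I_def
  \<comment> \<open>the sum with \<open>d\<close> in front, as a linear functional of its coefficient function\<close>
  define R where "R f = (\<Sum>d\<in>I. v d * x ^ d * f d)" for f
  have R: "(\<Sum>d\<in>I. g d) = R f" if "\<And>d. d \<in> I \<Longrightarrow> g d = v d * x ^ d * f d" for f g
    unfolding R_def using that by (rule sum.cong[OF refl])
  have R_add: "R (\<lambda>d. f d + g d) = R f + R g" and R_mult: "R (\<lambda>d. k * f d) = k * R f" for f g k
    by (simp_all add: R_def distrib_left sum.distrib sum_distrib_left mult.left_commute)
  have 1: "P [1,1,1,1] [1,1,1,x] = R (\<lambda>d. sum_triples I (\<lambda>a b c. of_bool (c < d) * (v a * v b * v c)))"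
  proof -
    have "P [1,1,1,1] [1,1,1,x] = (\<Sum>a\<in>I. \<Sum>b\<in>I. \<Sum>c\<in>I. \<Sum>d\<in>I. of_bool (a < b \<and> b < c \<and> c < d) * (v a * v b * v c * v d * x ^ d))"
      by (simp add: nested mult_ac)
    also have "\<dots> = (\<Sum>d\<in>I. \<Sum>a\<in>I. \<Sum>b\<in>I. \<Sum>c\<in>I. of_bool (a < b \<and> b < c \<and> c < d) * (v a * v b * v c * v d * x ^ d))"
      by (rule sum_swap_4)
    also have "\<dots> = R (\<lambda>d. sum_triples I (\<lambda>a b c. of_bool (c < d) * (v a * v b * v c)))"
      by (rule R) (simp only: sum_triples_def sum_distrib_left, intro sum.cong refl, auto simp: mult_ac)
    finally show ?thesis .
  qed
  have 2: "P [1,1,1,1] [1,1,x,1] = R (\<lambda>d. sum_triples I (\<lambda>a b c. of_bool (b < d \<and> d < c) * (v a * v b * v c)))"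
  proof -
    have "P [1,1,1,1] [1,1,x,1] = (\<Sum>a\<in>I. \<Sum>b\<in>I. \<Sum>d\<in>I. \<Sum>c\<in>I. of_bool (a < b \<and> b < d \<and> d < c) * (v a * v b * v d * v c * x ^ d))"
      by (simp add: nested mult_ac)
    also have "\<dots> = (\<Sum>d\<in>I. \<Sum>a\<in>I. \<Sum>b\<in>I. \<Sum>c\<in>I. of_bool (a < b \<and> b < d \<and> d < c) * (v a * v b * v d * v c * x ^ d))"
      by (rule sum_swap_3)
    also have "\<dots> = R (\<lambda>d. sum_triples I (\<lambda>a b c. of_bool (b < d \<and> d < c) * (v a * v b * v c)))"
      by (rule R) (simp only: sum_triples_def sum_distrib_left, intro sum.cong refl, auto simp: mult_ac)
    finally show ?thesis .
  qed
  have 3: "P [1,1,1,1] [1,x,1,1] = R (\<lambda>d. sum_triples I (\<lambda>a b c. of_bool (a < d \<and> d < b) * (v a * v b * v c)))"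
  proof -
    have "P [1,1,1,1] [1,x,1,1] = (\<Sum>a\<in>I. \<Sum>d\<in>I. \<Sum>b\<in>I. \<Sum>c\<in>I. of_bool (a < d \<and> d < b \<and> b < c) * (v a * v d * v b * v c * x ^ d))"
      by (simp add: nested mult_ac)
    also have "\<dots> = (\<Sum>d\<in>I. \<Sum>a\<in>I. \<Sum>b\<in>I. \<Sum>c\<in>I. of_bool (a < d \<and> d < b \<and> b < c) * (v a * v d * v b * v c * x ^ d))"
      by (rule sum.swap)
    also have "\<dots> = R (\<lambda>d. sum_triples I (\<lambda>a b c. of_bool (a < d \<and> d < b) * (v a * v b * v c)))"
      by (rule R) (simp only: sum_triples_def sum_distrib_left, intro sum.cong refl, auto simp: mult_ac)
    finally show ?thesis .
  qed
  have 4: "P [1,1,1,1] [x,1,1,1] = R (\<lambda>d. sum_triples I (\<lambda>a b c. of_bool (d < a) * (v a * v b * v c)))"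
  proof -
    have "P [1,1,1,1] [x,1,1,1] = (\<Sum>d\<in>I. \<Sum>a\<in>I. \<Sum>b\<in>I. \<Sum>c\<in>I. of_bool (d < a \<and> a < b \<and> b < c) * (v d * v a * v b * v c * x ^ d))"
      by (simp add: nested mult_ac)
    also have "\<dots> = R (\<lambda>d. sum_triples I (\<lambda>a b c. of_bool (d < a) * (v a * v b * v c)))"
      by (rule R) (simp only: sum_triples_def sum_distrib_left, intro sum.cong refl, auto simp: mult_ac)
    finally show ?thesis .
  qed
  have 5: "P [2,1,1] [x,1,1] = R (\<lambda>d. sum_triples I (\<lambda>a b c. of_bool (d = a) * (v a * v b * v c)))"
  proof -
    have "P [2,1,1] [x,1,1] = (\<Sum>d\<in>I. \<Sum>b\<in>I. \<Sum>c\<in>I. of_bool (d < b \<and> b < c) * (v d^2 * v b * v c * x ^ d))"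
      by (simp add: nested mult_ac)
    also have "\<dots> = R (\<lambda>d. sum_triples I (\<lambda>a b c. of_bool (d = a) * (v a * v b * v c)))"
      by (rule R) (simp only: sum_triples_eq[OF fin] sum_distrib_left, simp only: power2_eq_square mult_ac)
    finally show ?thesis .
  qed
  have 6: "P [1,2,1] [1,x,1] = R (\<lambda>d. sum_triples I (\<lambda>a b c. of_bool (d = b) * (v a * v b * v c)))"
  proof -
    have "P [1,2,1] [1,x,1] = (\<Sum>a\<in>I. \<Sum>d\<in>I. \<Sum>c\<in>I. of_bool (a < d \<and> d < c) * (v a * v d^2 * v c * x ^ d))"
      by (simp add: nested mult_ac)
    also have "\<dots> = (\<Sum>d\<in>I. \<Sum>a\<in>I. \<Sum>c\<in>I. of_bool (a < d \<and> d < c) * (v a * v d^2 * v c * x ^ d))"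
      by (rule sum.swap)
    also have "\<dots> = R (\<lambda>d. sum_triples I (\<lambda>a b c. of_bool (d = b) * (v a * v b * v c)))"
      by (rule R) (simp only: sum_triples_eq[OF fin] sum_distrib_left, simp only: power2_eq_square mult_ac)
    finally show ?thesis .
  qed
  have 7: "P [1,1,2] [1,1,x] = R (\<lambda>d. sum_triples I (\<lambda>a b c. of_bool (d = c) * (v a * v b * v c)))"
  proof -
    have "P [1,1,2] [1,1,x] = (\<Sum>a\<in>I. \<Sum>b\<in>I. \<Sum>d\<in>I. of_bool (a < b \<and> b < d) * (v a * v b * v d^2 * x ^ d))"
      by (simp add: nested mult_ac)
    also have "\<dots> = (\<Sum>d\<in>I. \<Sum>a\<in>I. \<Sum>b\<in>I. of_bool (a < b \<and> b < d) * (v a * v b * v d^2 * x ^ d))"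
      by (rule sum_swap_3)
    also have "\<dots> = R (\<lambda>d. sum_triples I (\<lambda>a b c. of_bool (d = c) * (v a * v b * v c)))"
      by (rule R) (simp only: sum_triples_eq[OF fin] sum_distrib_left, simp only: power2_eq_square mult_ac)
    finally show ?thesis .
  qed
  have 8: "P [2,1,1] [1,1,x] = R (\<lambda>d. sum_pairs I (\<lambda>a b. of_bool (b < d) * (v a ^ 2 * v b)))"
  proof -
    have "P [2,1,1] [1,1,x] = (\<Sum>a\<in>I. \<Sum>b\<in>I. \<Sum>d\<in>I. of_bool (a < b \<and> b < d) * (v a^2 * v b * v d * x ^ d))"
      by (simp add: nested mult_ac)
    also have "\<dots> = (\<Sum>d\<in>I. \<Sum>a\<in>I. \<Sum>b\<in>I. of_bool (a < b \<and> b < d) * (v a^2 * v b * v d * x ^ d))"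
      by (rule sum_swap_3)
    also have "\<dots> = R (\<lambda>d. sum_pairs I (\<lambda>a b. of_bool (b < d) * (v a ^ 2 * v b)))"
      by (rule R) (simp only: sum_pairs_def sum_distrib_left, intro sum.cong refl, auto simp: mult_ac)
    finally show ?thesis .
  qed
  have 9: "P [2,1,1] [1,x,1] = R (\<lambda>d. sum_pairs I (\<lambda>a b. of_bool (a < d \<and> d < b) * (v a ^ 2 * v b)))"
  proof -
    have "P [2,1,1] [1,x,1] = (\<Sum>a\<in>I. \<Sum>d\<in>I. \<Sum>b\<in>I. of_bool (a < d \<and> d < b) * (v a^2 * v d * v b * x ^ d))"
      by (simp add: nested mult_ac)
    also have "\<dots> = (\<Sum>d\<in>I. \<Sum>a\<in>I. \<Sum>b\<in>I. of_bool (a < d \<and> d < b) * (v a^2 * v d * v b * x ^ d))"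
      by (rule sum.swap)
    also have "\<dots> = R (\<lambda>d. sum_pairs I (\<lambda>a b. of_bool (a < d \<and> d < b) * (v a ^ 2 * v b)))"
      by (rule R) (simp only: sum_pairs_def sum_distrib_left, intro sum.cong refl, auto simp: mult_ac)
    finally show ?thesis .
  qed
  have 10: "P [1,2,1] [1,1,x] = R (\<lambda>d. sum_pairs I (\<lambda>a b. of_bool (b < d) * (v a * v b ^ 2)))"
  proof -
    have "P [1,2,1] [1,1,x] = (\<Sum>a\<in>I. \<Sum>b\<in>I. \<Sum>d\<in>I. of_bool (a < b \<and> b < d) * (v a * v b^2 * v d * x ^ d))"
      by (simp add: nested mult_ac)
    also have "\<dots> = (\<Sum>d\<in>I. \<Sum>a\<in>I. \<Sum>b\<in>I. of_bool (a < b \<and> b < d) * (v a * v b^2 * v d * x ^ d))"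
      by (rule sum_swap_3)
    also have "\<dots> = R (\<lambda>d. sum_pairs I (\<lambda>a b. of_bool (b < d) * (v a * v b ^ 2)))"
      by (rule R) (simp only: sum_pairs_def sum_distrib_left, intro sum.cong refl, auto simp: mult_ac)
    finally show ?thesis .
  qed
  have 11: "P [2,2] [1,x] = R (\<lambda>d. sum_pairs I (\<lambda>a b. of_bool (d = b) * (v a ^ 2 * v b)))"
  proof -
    have "P [2,2] [1,x] = (\<Sum>a\<in>I. \<Sum>d\<in>I. of_bool (a < d) * (v a^2 * v d^2 * x ^ d))"
      by (simp add: nested mult_ac)
    also have "\<dots> = (\<Sum>d\<in>I. \<Sum>a\<in>I. of_bool (a < d) * (v a^2 * v d^2 * x ^ d))"
      by (rule sum.swap)
    also have "\<dots> = R (\<lambda>d. sum_pairs I (\<lambda>a b. of_bool (d = b) * (v a ^ 2 * v b)))"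
      by (rule R) (simp only: sum_triples_eq[OF fin] sum_distrib_left, simp only: power2_eq_square mult_ac)
    finally show ?thesis .
  qed
  have 12: "P [1,1,2] [x,1,1] = R (\<lambda>d. sum_pairs I (\<lambda>a b. of_bool (d < a) * (v a * v b ^ 2)))"
  proof -
    have "P [1,1,2] [x,1,1] = (\<Sum>d\<in>I. \<Sum>a\<in>I. \<Sum>b\<in>I. of_bool (d < a \<and> a < b) * (v d * v a * v b^2 * x ^ d))"
      by (simp add: nested mult_ac)
    also have "\<dots> = R (\<lambda>d. sum_pairs I (\<lambda>a b. of_bool (d < a) * (v a * v b ^ 2)))"
      by (rule R) (simp only: sum_pairs_def sum_distrib_left, intro sum.cong refl, auto simp: mult_ac)
    finally show ?thesis .
  qed
  have 13: "P [1,1,2] [1,x,1] = R (\<lambda>d. sum_pairs I (\<lambda>a b. of_bool (a < d \<and> d < b) * (v a * v b ^ 2)))"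
  proof -
    have "P [1,1,2] [1,x,1] = (\<Sum>a\<in>I. \<Sum>d\<in>I. \<Sum>b\<in>I. of_bool (a < d \<and> d < b) * (v a * v d * v b^2 * x ^ d))"
      by (simp add: nested mult_ac)
    also have "\<dots> = (\<Sum>d\<in>I. \<Sum>a\<in>I. \<Sum>b\<in>I. of_bool (a < d \<and> d < b) * (v a * v d * v b^2 * x ^ d))"
      by (rule sum.swap)
    also have "\<dots> = R (\<lambda>d. sum_pairs I (\<lambda>a b. of_bool (a < d \<and> d < b) * (v a * v b ^ 2)))"
      by (rule R) (simp only: sum_pairs_def sum_distrib_left, intro sum.cong refl, auto simp: mult_ac)
    finally show ?thesis .
  qed
  have 14: "P [1,2,1] [x,1,1] = R (\<lambda>d. sum_pairs I (\<lambda>a b. of_bool (d < a) * (v a ^ 2 * v b)))"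
  proof -
    have "P [1,2,1] [x,1,1] = (\<Sum>d\<in>I. \<Sum>a\<in>I. \<Sum>b\<in>I. of_bool (d < a \<and> a < b) * (v d * v a^2 * v b * x ^ d))"
      by (simp add: nested mult_ac)
    also have "\<dots> = R (\<lambda>d. sum_pairs I (\<lambda>a b. of_bool (d < a) * (v a ^ 2 * v b)))"
      by (rule R) (simp only: sum_pairs_def sum_distrib_left, intro sum.cong refl, auto simp: mult_ac)
    finally show ?thesis .
  qed
  have 15: "P [2,2] [x,1] = R (\<lambda>d. sum_pairs I (\<lambda>a b. of_bool (d = a) * (v a * v b ^ 2)))"
  proof -
    have "P [2,2] [x,1] = (\<Sum>d\<in>I. \<Sum>b\<in>I. of_bool (d < b) * (v d^2 * v b^2 * x ^ d))"
      by (simp add: nested mult_ac)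
    also have "\<dots> = R (\<lambda>d. sum_pairs I (\<lambda>a b. of_bool (d = a) * (v a * v b ^ 2)))"
      by (rule R) (simp only: sum_triples_eq[OF fin] sum_distrib_left, simp only: power2_eq_square mult_ac)
    finally show ?thesis .
  qed
  have "descent_polylog p v T 4 x = R (descent_sum p v T 3)"
    by (simp add: R_def eval_nat_numeral I_def mult_ac del: descent_sum.simps)
  also have "\<dots> = R (\<lambda>d.
      (1 + 4 * T + T^2) * sum_triples I (\<lambda>a b c. of_bool (c < d) * (v a * v b * v c))
    + 2 * T * (2 + T) * sum_triples I (\<lambda>a b c. of_bool (b < d \<and> d < c) * (v a * v b * v c))
    + 2 * T * (1 + 2 * T) * sum_triples I (\<lambda>a b c. of_bool (a < d \<and> d < b) * (v a * v b * v c))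
    + T * (1 + 4 * T + T^2) * sum_triples I (\<lambda>a b c. of_bool (d < a) * (v a * v b * v c))
    + T * (1 + 3 * T) * sum_triples I (\<lambda>a b c. of_bool (d = a) * (v a * v b * v c))
    + 2 * T * (1 + T) * sum_triples I (\<lambda>a b c. of_bool (d = b) * (v a * v b * v c))
    + T * (3 + T) * sum_triples I (\<lambda>a b c. of_bool (d = c) * (v a * v b * v c))
    + (T * sum_pairs I (\<lambda>a b. of_bool (b < d) * (v a ^ 2 * v b))
      + T * sum_pairs I (\<lambda>a b. of_bool (a < d \<and> d < b) * (v a ^ 2 * v b))
      + T * sum_pairs I (\<lambda>a b. of_bool (b < d) * (v a * v b ^ 2))
      + T * sum_pairs I (\<lambda>a b. of_bool (d = b) * (v a ^ 2 * v b))
      + T^2 * sum_pairs I (\<lambda>a b. of_bool (d < a) * (v a * v b ^ 2))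
      + T^2 * sum_pairs I (\<lambda>a b. of_bool (a < d \<and> d < b) * (v a * v b ^ 2))
      + T^2 * sum_pairs I (\<lambda>a b. of_bool (d < a) * (v a ^ 2 * v b))
      + T^2 * sum_pairs I (\<lambda>a b. of_bool (d = a) * (v a * v b ^ 2))))"
    unfolding R_def I_def by (intro sum.cong refl arg_cong2[where f = "(*)"] descent_sum_3)
  finally show ?thesis
    by (simp only: R_add R_mult 1 2 3 4 5 6 7 8 9 10 11 12 13 14 15 distrib_left add.assoc)
qed


section \<open>Passage to the ring of families modulo almost all primes\<close>

text \<open>
  The summands contain the reciprocal of a product; both it and the product of the reciprocals are
  inverse to that product.
\<close>

lemma recip_prod_cong:
  assumes p: "prime p" and n: "\<And>i. i \<in> A \<Longrightarrow> n i \<in> {0<..<p}"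
  shows "of_int (modular_inverse (int p) (\<Prod>i\<in>A. int (n i) ^ k i))
    \<simeq>\<^bsub>p\<^esub> (\<Prod>i\<in>A. recip p (n i) ^ k i :: 'a::comm_ring_1)"
    (is "?l \<simeq>\<^bsub>p\<^esub> ?r")
proof -
  define N where "N = (\<Prod>i\<in>A. int (n i) ^ k i)"
  have "coprime (int (n i)) (int p)" if "i \<in> A" for i
    using n[OF that] p prime_imp_coprime[of p "n i"]
    by (auto simp: coprime_commute dest: nat_dvd_not_less)
  then have "coprime N (int p)"
    unfolding N_def by (intro prod_coprime_left) (simp add: coprime_power_left_iff)
  then have "[N * modular_inverse (int p) N = 1] (mod int p)"
    by (rule cong_modular_inverse1)
  from cong_mod_of_int[OF this] have l: "of_int N * ?l \<simeq>\<^bsub>p\<^esub> (1 :: 'a)"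
    by (simp add: N_def)
  have "(\<Prod>i\<in>A. (of_nat (n i) * recip p (n i)) ^ k i) \<simeq>\<^bsub>p\<^esub> (\<Prod>i\<in>A. 1 ^ k i :: 'a)"
    using n by (intro cong_mod_prod cong_mod_power recip_cong p) auto
  then have r: "of_int N * ?r \<simeq>\<^bsub>p\<^esub> 1"
    by (simp add: N_def power_mult_distrib prod.distrib of_int_prod)
  have "?l = ?l * 1" by simp
  also have "\<dots> \<simeq>\<^bsub>p\<^esub> ?l * (of_int N * ?r)"
    by (rule cong_mod_mult[OF cong_mod_refl cong_mod_sym[OF r]])
  also have "\<dots> = of_int N * ?l * ?r"
    by (simp only: mult_ac)
  also have "\<dots> \<simeq>\<^bsub>p\<^esub> 1 * ?r"
    by (rule cong_mod_mult[OF l cong_mod_refl])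
  finally show ?thesis by simp
qed

lemma mpoly_eval_0: "mpoly_eval x 0 = 0"
  by (simp add: mpoly_eval_def)

lemma mpoly_eval_add: "mpoly_eval x (q + r) = mpoly_eval x q + mpoly_eval x r"
  using mpoly_eval_diff[of x "q + r" r] by (simp add: algebra_simps)

lemma mpoly_eval_sum: "mpoly_eval x (sum f A) = (\<Sum>a\<in>A. mpoly_eval x (f a))"
  by (induction A rule: infinite_finite_induct) (simp_all add: mpoly_eval_0 mpoly_eval_add)

lemma mvar_power: "mvar i ^ n = Poly_Mapping.single (Poly_Mapping.single i n) 1"
  by (induction n) (simp_all add: mvar_def Poly_Mapping.mult_single flip: Poly_Mapping.single_add)

lemma mpoly_eval_monomial:
  "mpoly_eval x (of_int c * (\<Prod>i<r. mvar i ^ e i)) = of_int c * (\<Prod>i<r. x i ^ e i)"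
proof -
  define m where "m = (\<Sum>i<r. Poly_Mapping.single i (e i))"
  have m: "Poly_Mapping.lookup m i = (if i < r then e i else 0)" for i
    by (simp add: m_def lookup_sum lookup_single when_def)
  have "(\<Prod>i<r. mvar i ^ e i) = Poly_Mapping.single m 1"
    unfolding m_def by (induction r) (simp_all add: mvar_power Poly_Mapping.mult_single)
  then have "of_int c * (\<Prod>i<r. mvar i ^ e i) = Poly_Mapping.single m c"
    by (simp add: Poly_Mapping.mult_single flip: Poly_Mapping.single_of_int)
  moreover have "(\<Prod>i\<in>Poly_Mapping.keys m. x i ^ Poly_Mapping.lookup m i) = (\<Prod>i<r. x i ^ e i)"
    by (rule prod.mono_neutral_cong_left) (auto simp: m in_keys_iff split: if_splits)
  ultimately show ?thesis
    by (cases "c = 0") (simp_all add: mpoly_eval_def)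
qed

text \<open>
  The choice of representatives with separate reciprocals makes all further identities between
  polylogarithms at the same argument exact in \<open>\<int>[t]\<close> instead of congruences.
\<close>

lemma fin_polylog_star_eq:
  assumes "length xs = length ks"
  shows "\<pounds>\<^sup>* ks xs = abs_poor_adele (\<lambda>p. polylog_sum p (recip p) ks xs)"
proof -
  let ?N = "\<lambda>p. {ns. length ns = length ks \<and> sorted_wrt (<) ns \<and> set ns \<subseteq> {0<..<p}}"
  have "\<pounds>\<^sup>* ks xs = abs_poor_adele (\<lambda>p. \<Sum>ns\<in>?N p.
      of_int (modular_inverse (int p) (\<Prod>i<length ks. int (ns ! i) ^ (ks ! i))) *
      (\<Prod>i<length ks. xs ! i ^ (ns ! i)))"
    unfolding fin_polylog_star_def fin_polylog_def map_fun_apply id_apply substitute.abs_eq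
    by (simp only: mpoly_eval_sum mpoly_eval_monomial)
  also have "\<dots> = abs_poor_adele (\<lambda>p. polylog_sum p (recip p) ks xs)"
  proof -
    have "(\<Sum>ns\<in>?N p. of_int (modular_inverse (int p) (\<Prod>i<length ks. int (ns ! i) ^ (ks ! i))) *
        (\<Prod>i<length ks. xs ! i ^ (ns ! i))) \<simeq>\<^bsub>p\<^esub> polylog_sum p (recip p) ks xs" if "prime p" for p
      unfolding polylog_sum_def prod.distrib
    proof (rule cong_mod_sum, rule cong_mod_mult[OF recip_prod_cong[OF that] cong_mod_refl])
      fix ns i assume "ns \<in> ?N p" "i \<in> {..<length ks}"
      then have "ns ! i \<in> set ns" "set ns \<subseteq> {0<..<p}" by auto
      then show "ns ! i \<in> {0<..<p}" by blast
    qed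
    then show ?thesis
      by (simp add: poor_adele.abs_eq_iff eq_mod_almost_all_primes_def cong_mod_def cong: conj_cong)
  qed
  finally show ?thesis .
qed

lemma numeral_poor_adele: "numeral n = abs_poor_adele (\<lambda>_. numeral n)"
  by (induction n) (simp_all only: numeral.simps one_poor_adele_def plus_poor_adele.abs_eq)

theorem corollary4p4:
  shows "let t = [:0, 1:] :: int poly; T = tpow 1; T2 = tpow 2 in
      (1 + 4 * T + T2) * \<pounds> [1,1,1,1] t
    + 2 * T * (2 + T) * \<pounds>\<^sup>* [1,1,1,1] [1,1,t,1]
    + 2 * T * (1 + 2 * T) * \<pounds>\<^sup>* [1,1,1,1] [1,t,1,1]
    + T * (1 + 4 * T + T2) * \<pounds>\<^sup>~ [1,1,1,1] t
    + T * (1 + 3 * T) * \<pounds>\<^sup>~ [2,1,1] t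
    + 2 * T * (1 + T) * \<pounds>\<^sup>* [1,2,1] [1,t,1]
    + T * (3 + T) * \<pounds> [1,1,2] t
    + T * (\<pounds> [2,1,1] t + \<pounds>\<^sup>* [2,1,1] [1,t,1] + \<pounds> [1,2,1] t + \<pounds> [2,2] t)
    + T2 * (\<pounds>\<^sup>~ [1,1,2] t + \<pounds>\<^sup>* [1,1,2] [1,t,1] + \<pounds>\<^sup>~ [1,2,1] t + \<pounds>\<^sup>~ [2,2] t)
    = (6 - 6 * T + T2) * \<pounds> [1,1,1,1] (1 - t)
    + 2 * (1 - T) * (3 - T) * \<pounds>\<^sup>* [1,1,1,1] [1,1,1 - t,1]
    + 2 * (1 - T) * (3 - 2 * T) * \<pounds>\<^sup>* [1,1,1,1] [1,1 - t,1,1]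
    + (1 - T) * (6 - 6 * T + T2) * \<pounds>\<^sup>~ [1,1,1,1] (1 - t)
    + (1 - T) * (4 - 3 * T) * \<pounds>\<^sup>~ [2,1,1] (1 - t)
    + 2 * (1 - T) * (2 - T) * \<pounds>\<^sup>* [1,2,1] [1,1 - t,1]
    + (1 - T) * (4 - T) * \<pounds> [1,1,2] (1 - t)
    + (1 - T) * (\<pounds> [2,1,1] (1 - t) + \<pounds>\<^sup>* [2,1,1] [1,1 - t,1]
        + \<pounds> [1,2,1] (1 - t) + \<pounds> [2,2] (1 - t))
    + (1 - T)^2 * (\<pounds>\<^sup>~ [1,1,2] (1 - t) + \<pounds>\<^sup>* [1,1,2] [1,1 - t,1]
        + \<pounds>\<^sup>~ [1,2,1] (1 - t) + \<pounds>\<^sup>~ [2,2] (1 - t))"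
proof -
  define t :: "int poly" where "t = [:0, 1:]"
  define P where "P ks xs = abs_poor_adele (\<lambda>p. polylog_sum p (recip p) ks xs)"
    for ks and xs :: "int poly list"
  have polylog:
    "\<pounds> [a, b] x = P [a, b] [1, x]" "\<pounds> [a, b, c] x = P [a, b, c] [1, 1, x]"
    "\<pounds> [a, b, c, d] x = P [a, b, c, d] [1, 1, 1, x]"
    "\<pounds>\<^sup>~ [a, b] x = P [a, b] [x, 1]" "\<pounds>\<^sup>~ [a, b, c] x = P [a, b, c] [x, 1, 1]"
    "\<pounds>\<^sup>~ [a, b, c, d] x = P [a, b, c, d] [x, 1, 1, 1]"
    "\<pounds>\<^sup>* [a, b, c] [x, y, z] = P [a, b, c] [x, y, z]"
    "\<pounds>\<^sup>* [a, b, c, d] [x, y, z, w] = P [a, b, c, d] [x, y, z, w]" for a b c d x y z w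
    by (simp_all add: fin_polylog_last_def fin_polylog_first_def fin_polylog_star_eq P_def)
  have tpow: "tpow 1 = abs_poor_adele (\<lambda>p. t ^ p)" "tpow 2 = abs_poor_adele (\<lambda>p. (t ^ p)^2)"
    by (simp_all add: tpow_def t_def monom_altdef mult.commute flip: power_mult)
  have square: "(abs_poor_adele f)^2 = abs_poor_adele (\<lambda>p. (f p)^2)" for f :: "nat \<Rightarrow> int poly"
    by (simp add: power2_eq_square times_poor_adele.abs_eq)
  note arith = one_poor_adele_def numeral_poor_adele plus_poor_adele.abs_eq minus_poor_adele.abs_eq
    times_poor_adele.abs_eq square
  let ?F = "abs_poor_adele (\<lambda>p. descent_polylog p (recip p) (t ^ p) 4 t)"
  let ?H = "abs_poor_adele (\<lambda>p. descent_polylog p (recip p) (1 - t ^ p) 4 (1 - t))"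
  have "?F = ?H"
  proof -
    \<comment> \<open>The primes up to \<open>2^4\<close> are the finitely many to be ignored.\<close>
    have "{p. prime p \<and> \<not> of_nat p dvd descent_polylog p (recip p) (t ^ p) 4 t
        - descent_polylog p (recip p) (1 - t ^ p) 4 (1 - t)} \<subseteq> {..2 ^ 4}"
      using descent_polylog_reflection[of _ 4] unfolding cong_mod_def t_def[symmetric]
      by (auto simp: not_less[symmetric] simp del: of_nat_dvd_iff)
    then show ?thesis
      unfolding poor_adele.abs_eq_iff eq_mod_almost_all_primes_def by (rule finite_subset) simp
  qed
  \<comment> \<open>the coefficients on the right are those on the left at \<open>1 - T\<close>\<close>
  have coefficients:
    "6 - 6 * T + T^2 = 1 + 4 * (1 - T) + (1 - T)^2"
    "3 - T = 2 + (1 - T)" "3 - 2 * T = 1 + 2 * (1 - T)" "4 - 3 * T = 1 + 3 * (1 - T)"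
    "2 - T = 1 + (1 - T)" "4 - T = 3 + (1 - T)" for T :: "int poly"
    by (simp_all add: power2_eq_square algebra_simps)
  show ?thesis
    unfolding Let_def t_def[symmetric] polylog
    unfolding P_def tpow arith coefficients[of "t ^ p" for p] descent_polylog_4[symmetric]
    by (rule \<open>?F = ?H\<close>)
qed

end
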